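(* For $b,c\in\mathcal M_\bullet$ set $$F_b\cdot F_c\ :=\ \boldsymbol\beta(F_w\cdot F_v),$$ where $w,v\in\mathfrak S_\bullet$ are permutations with $\beta(w)=b$ and $\beta(v)=c$, and $F_w\cdot F_v$ is the product in $\mathfrak SSym$. Then $F_b\cdot F_c$ is independent of the choices of $w,v$ with $\beta(w)=b$ and $\beta(v)=c$, and it endows $\mathcal MSym$ with the structure of a graded connected algebra such that the map $\boldsymbol\beta\colon\mathfrak SSym\to\mathcal MSym$ is a surjective map of graded connected algebras.
   Context: Permutations. $\mathfrak S_n$ is the set of permutations of $\{1,\dots,n\}$, written as words $w(1)\cdots w(n)$; $\mathfrak S_0=\{\emptyset\}$; $\mathfrak S_\bullet=\bigsqcup_n\mathfrak S_n$. For a word $a$ with distinct integer letters, $\overline a$ is its standardization (the permutation with the same relative order). Trees. $\mathcal Y_n$ is the set of rooted planar binary trees with $n$ internal nodes; $|$ is the tree with no nodes; $t_\ell\vee t_r$ is the tree whose root node has left subtree $t_\ell$ and right subtree $t_r$. The nodes of $t\in\mathcal Y_n$ are numbered $1,\dots,n$ from left to right (node $i$ corresponds to the gap between consecutive leaves $i-1$ and $i$). The node poset of $t$ has the internal edges as Hasse diagram and the root as maximum. The map $\tau\colon\mathfrak S_n\to\mathcal Y_n$ is defined by $\tau(\emptyset)=|$ and, if $w(j)=n$, $\tau(w)=\tau(\overline{w(1)\cdots w(j-1)})\vee\tau(\overline{w(j+1)\cdots w(n)})$. Bi-leveled trees. A bi-leveled tree with $n$ nodes is a pair $(t;\mathsf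 T)$ with $t\in\mathcal Y_n$ and $\mathsf T\subseteq\{1,\dots,n\}$ an upper order ideal of the node poset of $t$ containing the leftmost node (node $1$) as a minimal element of $\mathsf T$. $\mathcal M_n$ is the set of these; $\mathcal M_0=\{|\}$ (with empty ideal); $\mathcal M_\bullet=\bigsqcup_n\mathcal M_n$. The surjection $\beta\colon\mathfrak S_n\to\mathcal M_n$ is $\beta(w)=(\tau(w);\mathsf T(w))$ with $\mathsf T(w)=\{i\mid w(i)\ge w(1)\}$. Algebras. $\mathfrak SSym=\bigoplus_{n\ge0}\mathfrak SSym_n$ is the graded $\mathbb Q$-vector space with basis $\{F_w\mid w\in\mathfrak S_n\}$ in degree $n$, with the Malvenuto–Reutenauer product: for $w\in\mathfrak S_n$, $v\in\mathfrak S_m$, $$F_w\cdot F_v=\sum F_{(w_0,\dots,w_m)/v},$$ where the sum is over all $0\le i_1\le\dots\le i_m\le n$, the word $w$ is cut after positions $i_1,\dots,i_m$ into consecutive (possibly empty) subwords $w_0,w_1,\dots,w_m$, and $(w_0,\dots,w_m)/v$ is the permutation $w_0\,(n+v(1))\,w_1\,(n+v(2))\cdots(n+v(m))\,w_m$ of $\{1,\dots,n+m\}$. The unit is $F_\emptyset$. $\mathcal MSym=\bigoplus_{n\ge0}\mathcal MSym_n$ is the graded $\mathbb Q$-vector space with basis $\{F_b\mid b\in\mathcal M_n\}$ in degree $n$, and $\boldsymbol\beta\colon\mathfrak SSym\to\mathcal MSym$ is the linear map $F_w\mapsto F_{\beta(w)}$. "Algebra" means associative unital algebra; a graded algebra is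 connected if its degree-$0$ part is one-dimensional, spanned by the unit. *)

theory Defs
  imports Complex_Main "HOL-Library.Poly_Mapping" "HOL-Library.Multiset" "HOL-Library.Tree"
begin

locale graded_algebra = vector_space scale
  for scale :: "'k::field \<Rightarrow> 'a::ab_group_add \<Rightarrow> 'a" +
  fixes mult :: "'a \<Rightarrow> 'a \<Rightarrow> 'a"
    and one :: 'a
    and hcomp :: "nat \<Rightarrow> 'a set"
  assumes mult_linear_left: "Vector_Spaces.linear scale scale (\<lambda>x. mult x y)"
    and mult_linear_right: "Vector_Spaces.linear scale scale (\<lambda>y. mult x y)"
    and mult_assoc: "mult (mult x y) z = mult x (mult y z)"
    and mult_one_left: "mult one x = x"
    and mult_one_right: "mult x one = x"
    and subspace_hcomp: "subspace (hcomp n)"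
    and hcomp_direct_sum:
      "\<exists>!c. (\<forall>n. c n \<in> hcomp n) \<and> finite {n. c n \<noteq> 0} \<and> x = (\<Sum>n\<in>{n. c n \<noteq> 0}. c n)"
    and one_hcomp: "one \<in> hcomp 0"
    and mult_hcomp: "\<lbrakk>x \<in> hcomp m; y \<in> hcomp n\<rbrakk> \<Longrightarrow> mult x y \<in> hcomp (m + n)"

locale graded_connected_algebra = graded_algebra +
  assumes dim_hcomp_0: "dim (hcomp 0) = 1"
    and hcomp_0_eq_span: "hcomp 0 = span {one}"

locale graded_connected_algebra_hom =
  A: graded_connected_algebra scaleA multA oneA hcompA +
  B: graded_connected_algebra scaleB multB oneB hcompB +
  Vector_Spaces.linear scaleA scaleB f
  for scaleA :: "'k::field \<Rightarrow> 'a::ab_group_add \<Rightarrow> 'a" and multA oneA hcompA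
    and scaleB :: "'k::field \<Rightarrow> 'b::ab_group_add \<Rightarrow> 'b" and multB oneB hcompB
    and f :: "'a \<Rightarrow> 'b" +
  assumes hom_mult: "f (multA x y) = multB (f x) (f y)"
    and hom_one: "f oneA = oneB"
    and hom_hcomp: "x \<in> hcompA n \<Longrightarrow> f x \<in> hcompB n"

text \<open>Letters are natural numbers; the letter $w(i)$ is \<open>w ! (i - 1)\<close>.\<close>

definition is_perm_word :: "nat list \<Rightarrow> bool" where
  "is_perm_word w \<longleftrightarrow> distinct w \<and> set w = {1..length w}"

typedef perm_word = "{w. is_perm_word w}"
  morphisms word_of Perm
  by (rule exI[of _ "[]"]) (simp add: is_perm_word_def)

definition perm_size :: "perm_word \<Rightarrow> nat" where
  "perm_size w = length (word_of w)"

definition standardize :: "nat list \<Rightarrow> nat list" where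
  "standardize a = map (\<lambda>x. card {y \<in> set a. y \<le> x}) a"

text \<open>Only the internal nodes are represented by \<^const>\<open>Node\<close>; their number is the
  \<^const>\<open>size\<close> of the tree. Nodes are numbered from 1, from left to right (in-order).\<close>

type_synonym ptree = "unit tree"

abbreviation wedge :: "ptree \<Rightarrow> ptree \<Rightarrow> ptree" (infix "\<or>\<^sub>t" 65) where
  "l \<or>\<^sub>t r \<equiv> Node l () r"

fun root_node :: "ptree \<Rightarrow> nat" where
  "root_node Leaf = 0"
| "root_node (Node l _ r) = size l + 1"

text \<open>The internal edges, as pairs (child, parent).\<close>

fun internal_edges :: "ptree \<Rightarrow> (nat \<times> nat) set" where
  "internal_edges Leaf = {}"
| "internal_edges (Node l _ r) =
     internal_edges l
     \<union> (\<lambda>(i, j). (i + (size l + 1), j + (size l + 1))) ` internal_edges r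
     \<union> (if l = Leaf then {} else {(root_node l, size l + 1)})
     \<union> (if r = Leaf then {} else {(root_node r + (size l + 1), size l + 1)})"

definition node_le :: "ptree \<Rightarrow> nat \<Rightarrow> nat \<Rightarrow> bool" where
  "node_le t i j \<longleftrightarrow> i \<in> {1..size t} \<and> j \<in> {1..size t} \<and> (i, j) \<in> (internal_edges t)\<^sup>*"

text \<open>On a permutation the maximal letter is $n$, the length of the word.\<close>

function (sequential) tau :: "nat list \<Rightarrow> ptree" where
  "tau [] = Leaf"
| "tau w =
     tau (standardize (takeWhile (\<lambda>x. x \<noteq> Max (set w)) w)) \<or>\<^sub>t
     tau (standardize (tl (dropWhile (\<lambda>x. x \<noteq> Max (set w)) w)))"
  by pat_completeness auto

lemma length_takeWhile_Max:
  assumes "w \<noteq> []"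
  shows "length (takeWhile (\<lambda>x. x \<noteq> Max (set w)) w) < length w"
proof -
  have "takeWhile (\<lambda>x. x \<noteq> Max (set w)) w \<noteq> w"
    using assms Max_in[of "set w"] by (auto simp: takeWhile_eq_all_conv)
  then show ?thesis
    by (metis le_neq_implies_less length_takeWhile_le takeWhile_eq_take take_all_iff order_refl)
qed

lemma length_tl_dropWhile: "w \<noteq> [] \<Longrightarrow> length (tl (dropWhile P w)) < length w"
  using length_dropWhile_le[of P w] by (cases w) (auto simp: less_Suc_eq_le)

termination tau
  by (relation "measure length")
    (simp_all only: in_measure wf_measure standardize_def length_map
      length_takeWhile_Max length_tl_dropWhile list.distinct not_False_eq_True)

definition upper_order_ideal :: "ptree \<Rightarrow> nat set \<Rightarrow> bool" where
  "upper_order_ideal t T \<longleftrightarrow>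
     T \<subseteq> {1..size t} \<and> (\<forall>i\<in>T. \<forall>j. node_le t i j \<longrightarrow> j \<in> T)"

definition is_bileveled :: "ptree \<times> nat set \<Rightarrow> bool" where
  "is_bileveled = (\<lambda>(t, T). upper_order_ideal t T \<and>
     (t \<noteq> Leaf \<longrightarrow> 1 \<in> T \<and> (\<forall>i\<in>T. node_le t i 1 \<longrightarrow> i = 1)))"

typedef bileveled = "{b. is_bileveled b}"
  morphisms pair_of Bileveled
  by (rule exI[of _ "(Leaf, {})"]) (simp add: is_bileveled_def upper_order_ideal_def)

definition bileveled_size :: "bileveled \<Rightarrow> nat" where
  "bileveled_size b = size (fst (pair_of b))"

definition upper_nodes :: "nat list \<Rightarrow> nat set" where
  "upper_nodes w = {i \<in> {1..length w}. w ! (i - 1) \<ge> w ! 0}"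

definition beta :: "perm_word \<Rightarrow> bileveled" where
  "beta w = Bileveled (tau (word_of w), upper_nodes (word_of w))"

definition pm_scale :: "rat \<Rightarrow> ('b \<Rightarrow>\<^sub>0 rat) \<Rightarrow> ('b \<Rightarrow>\<^sub>0 rat)" where
  "pm_scale c f = Poly_Mapping.map (\<lambda>x. c * x) f"

abbreviation F :: "'b \<Rightarrow> ('b \<Rightarrow>\<^sub>0 rat)" where
  "F b \<equiv> Poly_Mapping.single b 1"

definition linear_ext :: "('b \<Rightarrow> ('c \<Rightarrow>\<^sub>0 rat)) \<Rightarrow> ('b \<Rightarrow>\<^sub>0 rat) \<Rightarrow> ('c \<Rightarrow>\<^sub>0 rat)" where
  "linear_ext \<phi> f = (\<Sum>b\<in>Poly_Mapping.keys f. pm_scale (Poly_Mapping.lookup f b) (\<phi> b))"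

definition bilinear_ext ::
  "('b \<Rightarrow> 'b \<Rightarrow> ('b \<Rightarrow>\<^sub>0 rat)) \<Rightarrow> ('b \<Rightarrow>\<^sub>0 rat) \<Rightarrow> ('b \<Rightarrow>\<^sub>0 rat) \<Rightarrow> ('b \<Rightarrow>\<^sub>0 rat)" where
  "bilinear_ext \<mu> f g = linear_ext (\<lambda>b. linear_ext (\<lambda>c. \<mu> b c) g) f"

type_synonym ssym = "perm_word \<Rightarrow>\<^sub>0 rat"
type_synonym msym = "bileveled \<Rightarrow>\<^sub>0 rat"

definition ssym_hcomp :: "nat \<Rightarrow> ssym set" where
  "ssym_hcomp n = {f. \<forall>w\<in>Poly_Mapping.keys f. perm_size w = n}"

definition msym_hcomp :: "nat \<Rightarrow> msym set" where
  "msym_hcomp n = {f. \<forall>b\<in>Poly_Mapping.keys f. bileveled_size b = n}"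

text \<open>A cut of a word of length $n$ into $m+1$ pieces is the sequence
  $0 \le i_1 \le \dots \le i_m \le n$ of the positions after which it is cut.\<close>

definition cuts :: "nat \<Rightarrow> nat \<Rightarrow> nat list set" where
  "cuts n m = {is. length is = m \<and> sorted is \<and> set is \<subseteq> {0..n}}"

definition cut_word :: "nat list \<Rightarrow> nat list \<Rightarrow> nat list list" where
  "cut_word w is = map2 (\<lambda>i j. drop i (take j w)) (0 # is) (is @ [length w])"

text \<open>\<open>insert_letters n [w0, \<dots>, wm] v\<close> is $w_0\,(n+v(1))\,w_1 \cdots (n+v(m))\,w_m$.\<close>

definition insert_letters :: "nat \<Rightarrow> nat list list \<Rightarrow> nat list \<Rightarrow> nat list" where
  "insert_letters n ws v = hd ws @ concat (map2 (\<lambda>a u. (n + a) # u) v (tl ws))"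

definition shuffle :: "perm_word \<Rightarrow> perm_word \<Rightarrow> nat list \<Rightarrow> perm_word" where
  "shuffle w v is =
     Perm (insert_letters (perm_size w) (cut_word (word_of w) is) (word_of v))"

definition ssym_mult :: "ssym \<Rightarrow> ssym \<Rightarrow> ssym" where
  "ssym_mult = bilinear_ext
     (\<lambda>w v. \<Sum>is\<in>cuts (perm_size w) (perm_size v). F (shuffle w v is))"

definition ssym_one :: ssym where
  "ssym_one = F (Perm [])"

definition beta_lin :: "ssym \<Rightarrow> msym" where
  "beta_lin = linear_ext (\<lambda>w. F (beta w))"

text \<open>The product of basis elements is computed from arbitrarily chosen preimages under
  \<^const>\<open>beta\<close>; that the choice is irrelevant is something to be proved.\<close>

definition msym_mult :: "msym \<Rightarrow> msym \<Rightarrow> msym" where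
  "msym_mult = bilinear_ext
     (\<lambda>b c. beta_lin (ssym_mult (F (SOME w. beta w = b)) (F (SOME v. beta v = c))))"

definition msym_one :: msym where
  "msym_one = F (Bileveled (Leaf, {}))"


text \<open>The remaining facts show that \<^const>\<open>Bileveled\<close> and \<^const>\<open>Perm\<close> were only
  applied above to representatives satisfying the defining predicates.\<close>

lemma word_of_perm: "is_perm_word (word_of w)"
  using word_of by auto

lemma pair_of_Bileveled_Leaf: "pair_of (Bileveled (Leaf, {})) = (Leaf, {})"
  by (rule Bileveled_inverse) (simp add: is_bileveled_def upper_order_ideal_def)

lemma word_of_Perm_Nil: "word_of (Perm []) = []"
  by (rule Perm_inverse) (simp add: is_perm_word_def)

lemma length_standardize [simp]: "length (standardize a) = length a"
  by (simp add: standardize_def)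

lemma standardize_less_iff:
  assumes "i < length a" "j < length a"
  shows "standardize a ! i < standardize a ! j \<longleftrightarrow> a ! i < a ! j"
proof -
  have *: "card {y \<in> set a. y \<le> a ! i} < card {y \<in> set a. y \<le> a ! j}"
    if "a ! i < a ! j" "j < length a" for i j
  proof (rule psubset_card_mono)
    have "a ! j \<in> {y \<in> set a. y \<le> a ! j}" "a ! j \<notin> {y \<in> set a. y \<le> a ! i}"
      using that by auto
    moreover have "{y \<in> set a. y \<le> a ! i} \<subseteq> {y \<in> set a. y \<le> a ! j}"
      using that by auto
    ultimately show "{y \<in> set a. y \<le> a ! i} \<subset> {y \<in> set a. y \<le> a ! j}"
      by blast
  qed simp
  have "standardize a ! i = card {y \<in> set a. y \<le> a ! i}"
    "standardize a ! j = card {y \<in> set a. y \<le> a ! j}"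
    using assms by (simp_all add: standardize_def)
  then show ?thesis
    using *[of i j] *[of j i] assms by (metis less_asym less_irrefl linorder_neqE_nat)
qed

lemma distinct_standardize: "distinct a \<Longrightarrow> distinct (standardize a)"
  by (metis distinct_conv_nth length_standardize linorder_neq_iff standardize_less_iff)

lemma split_at_Max:
  assumes "w \<noteq> []"
  shows "w = takeWhile (\<lambda>x. x \<noteq> Max (set w)) w
           @ Max (set w) # tl (dropWhile (\<lambda>x. x \<noteq> Max (set w)) w)"
proof -
  let ?P = "\<lambda>x. x \<noteq> Max (set w)"
  have "dropWhile ?P w \<noteq> []"
    using assms Max_in[of "set w"] by (auto simp: dropWhile_eq_Nil_conv)
  then have "dropWhile ?P w = Max (set w) # tl (dropWhile ?P w)"
    by (metis (mono_tags, lifting) hd_dropWhile list.collapse)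
  then show ?thesis
    by (metis takeWhile_dropWhile_id)
qed

lemma size_tau: "size (tau w) = length w"
proof (induction w rule: tau.induct)
  case (2 x xs)
  define a where "a = takeWhile (\<lambda>y. y \<noteq> Max (set (x # xs))) (x # xs)"
  define b where "b = tl (dropWhile (\<lambda>y. y \<noteq> Max (set (x # xs))) (x # xs))"
  have "x # xs = a @ Max (set (x # xs)) # b"
    unfolding a_def b_def by (rule split_at_Max) simp
  then have "length (x # xs) = length a + length b + 1"
    by (metis add.assoc length_append list.size(4) One_nat_def)
  moreover have "tau (x # xs) = tau (standardize a) \<or>\<^sub>t tau (standardize b)"
    unfolding a_def b_def by (rule tau.simps)
  moreover have "size (tau (standardize a)) = length a" "size (tau (standardize b)) = length b"
    using "2.IH"[folded a_def b_def] by simp_all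
  ultimately show ?case
    by (simp only: tree.size)
qed simp

lemma internal_edges_bounds:
  "internal_edges t \<subseteq> {1..size t} \<times> {1..size t}"
  and root_node_bounds: "t \<noteq> Leaf \<Longrightarrow> root_node t \<in> {1..size t}"
proof -
  show root: "t \<noteq> Leaf \<Longrightarrow> root_node t \<in> {1..size t}" for t :: ptree
    by (cases t) auto
  show "internal_edges t \<subseteq> {1..size t} \<times> {1..size t}"
  proof (induction t)
    case (Node l x r)
    then show ?case
      using root[of l] root[of r] by (force split: if_splits)
  qed simp
qed

lemma internal_edges_tau_less:
  assumes "distinct w" "(i, j) \<in> internal_edges (tau w)"
  shows "w ! (i - 1) < w ! (j - 1)"
  using assms
proof (induction w arbitrary: i j rule: tau.induct)
  case (2 x xs)
  let ?w = "x # xs"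
  define a where "a = takeWhile (\<lambda>x. x \<noteq> Max (set ?w)) ?w"
  define b where "b = tl (dropWhile (\<lambda>x. x \<noteq> Max (set ?w)) ?w)"
  define M where "M = Max (set ?w)"
  have w: "?w = a @ M # b"
    unfolding a_def b_def M_def by (rule split_at_Max) simp
  have dist: "distinct (a @ M # b)" using "2.prems"(1) w by simp
  have less_M: "y < M" if "y \<in> set a \<union> set b" for y
  proof -
    have "y \<in> set ?w" using that w by auto
    then have "y \<le> M" unfolding M_def by simp
    moreover have "y \<noteq> M" using that dist by auto
    ultimately show ?thesis by simp
  qed
  have IH1: "a ! (i - 1) < a ! (j - 1)"
    if "(i, j) \<in> internal_edges (tau (standardize a))" for i j
  proof -
    have "standardize a ! (i - 1) < standardize a ! (j - 1)"
      using "2.IH"(1)[folded a_def] that distinct_standardize dist by simp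
    moreover have "i - 1 < length a" "j - 1 < length a"
      using internal_edges_bounds[of "tau (standardize a)"] that by (force simp: size_tau)+
    ultimately show ?thesis by (simp add: standardize_less_iff)
  qed
  have IH2: "b ! (i - 1) < b ! (j - 1)"
    if "(i, j) \<in> internal_edges (tau (standardize b))" for i j
  proof -
    have "standardize b ! (i - 1) < standardize b ! (j - 1)"
      using "2.IH"(2)[folded b_def] that distinct_standardize dist by simp
    moreover have "i - 1 < length b" "j - 1 < length b"
      using internal_edges_bounds[of "tau (standardize b)"] that by (force simp: size_tau)+
    ultimately show ?thesis by (simp add: standardize_less_iff)
  qed
  have tau_w: "tau ?w = tau (standardize a) \<or>\<^sub>t tau (standardize b)"
    unfolding a_def b_def by (rule tau.simps)
  consider
      (l) "(i, j) \<in> internal_edges (tau (standardize a))"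
    | (r) i' j' where "(i', j') \<in> internal_edges (tau (standardize b))"
        "i = i' + (length a + 1)" "j = j' + (length a + 1)"
    | (rl) "i \<in> {1..length a}" "j = length a + 1"
    | (rr) i' where "i' \<in> {1..length b}" "i = i' + (length a + 1)" "j = length a + 1"
    using "2.prems"(2) root_node_bounds[of "tau (standardize a)"]
      root_node_bounds[of "tau (standardize b)"]
    unfolding tau_w by (auto simp: size_tau split: if_splits)
  then show ?case
  proof cases
    case l
    then have "i - 1 < length a" "j - 1 < length a"
      using internal_edges_bounds[of "tau (standardize a)"] by (force simp: size_tau)+
    with IH1[OF l] show ?thesis unfolding w by (simp add: nth_append)
  next
    case r
    then have "1 \<le> i'" "1 \<le> j'"
      using internal_edges_bounds[of "tau (standardize b)"] by auto
    with IH2[OF r(1)] r show ?thesis unfolding w by (simp add: nth_append nth_Cons')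
  next
    case rl
    then have "a ! (i - 1) \<in> set a" by auto
    with less_M rl show ?thesis unfolding w by (auto simp: nth_append)
  next
    case rr
    then have "b ! (i' - 1) \<in> set b" by auto
    with less_M rr show ?thesis unfolding w by (auto simp: nth_append nth_Cons')
  qed
qed simp

lemma node_le_tau:
  assumes "distinct w" "node_le (tau w) i j"
  shows "i = j \<or> w ! (i - 1) < w ! (j - 1)"
proof -
  have "(i, j) \<in> (internal_edges (tau w))\<^sup>*" using assms by (simp add: node_le_def)
  then show ?thesis
  proof (induction rule: rtrancl_induct)
    case (step y z)
    then show ?case using internal_edges_tau_less[OF assms(1), of y z] by auto
  qed simp
qed

lemma pair_of_beta: "pair_of (beta w) = (tau (word_of w), upper_nodes (word_of w))"
proof -
  have d: "distinct (word_of w)" using word_of_perm by (simp add: is_perm_word_def)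
  have "is_bileveled (tau (word_of w), upper_nodes (word_of w))"
    unfolding is_bileveled_def upper_order_ideal_def upper_nodes_def prod.case
  proof (intro conjI impI ballI allI)
    fix i j
    assume "i \<in> {i \<in> {1..length (word_of w)}. word_of w ! 0 \<le> word_of w ! (i - 1)}"
      and le: "node_le (tau (word_of w)) i j"
    then show "j \<in> {i \<in> {1..length (word_of w)}. word_of w ! 0 \<le> word_of w ! (i - 1)}"
      using node_le_tau[OF d le] by (auto simp: node_le_def size_tau)
  next
    assume "tau (word_of w) \<noteq> Leaf"
    then have "word_of w \<noteq> []" by auto
    then show "1 \<in> {i \<in> {1..length (word_of w)}. word_of w ! 0 \<le> word_of w ! (i - 1)}"
      by (simp add: Suc_le_eq)
  next
    fix i
    assume "i \<in> {i \<in> {1..length (word_of w)}. word_of w ! 0 \<le> word_of w ! (i - 1)}"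
      and le: "node_le (tau (word_of w)) i 1"
    then show "i = 1" using node_le_tau[OF d le] by auto
  qed (auto simp: size_tau)
  then show ?thesis unfolding beta_def by (simp add: Bileveled_inverse)
qed

lemma mset_insert_letters:
  "length us = length v \<Longrightarrow>
    mset (insert_letters n (u # us) v) = mset (concat (u # us)) + mset (map ((+) n) v)"
  unfolding insert_letters_def
proof (induction us v arbitrary: u rule: list_induct2)
  case (Cons x xs y ys)
  then show ?case by simp
qed simp

lemma concat_cut:
  "\<lbrakk>sorted (i # is); set (i # is) \<subseteq> {0..length w}\<rbrakk> \<Longrightarrow>
    concat (map2 (\<lambda>i j. drop i (take j w)) (i # is) (is @ [length w])) = drop i w"
proof (induction "is" arbitrary: i)
  case (Cons j js)
  then have "drop i (take j w) @ drop j w = drop i w"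
    using drop_append[of i "take j w" "drop j w"] by simp
  with Cons show ?case by simp
qed simp

lemma word_of_shuffle:
  assumes "is \<in> cuts (perm_size w) (perm_size v)"
  shows "word_of (shuffle w v is) =
    insert_letters (perm_size w) (cut_word (word_of w) is) (word_of v)" (is "_ = ?u")
proof -
  let ?w = "word_of w" and ?v = "word_of v"
  obtain x xs where xs: "cut_word ?w is = x # xs" "length xs = length ?v"
    using assms unfolding cut_word_def cuts_def perm_size_def
    by (cases "is") auto
  have "concat (cut_word ?w is) = ?w"
    using assms concat_cut[of 0 "is" ?w] by (simp add: cut_word_def cuts_def perm_size_def)
  then have m: "mset ?u = mset (?w @ map ((+) (length ?w)) ?v)"
    using mset_insert_letters[OF xs(2), where n = "length ?w" and u = x] xs(1) by (simp add: perm_size_def)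
  have "is_perm_word (?w @ map ((+) (length ?w)) ?v)"
  proof -
    have w: "distinct ?w" "set ?w = {1..length ?w}" and v: "distinct ?v" "set ?v = {1..length ?v}"
      using word_of_perm[of w] word_of_perm[of v] by (auto simp: is_perm_word_def)
    have s: "set (map ((+) (length ?w)) ?v) = {length ?w + 1..length ?w + length ?v}"
      using v(2) by simp
    show ?thesis
      unfolding is_perm_word_def distinct_append set_append s w(2)
      using w(1) v(1) by (auto simp: distinct_map)
  qed
  then have "is_perm_word ?u"
    using m mset_eq_setD[OF m] mset_eq_length[OF m] mset_eq_imp_distinct_iff[OF m]
    by (simp add: is_perm_word_def)
  then show ?thesis unfolding shuffle_def by (simp add: Perm_inverse)
qed

end

theory Submission
  imports Defs "HOL-Library.Sublist"
begin

text \<open>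
  The tree of a permutation records, for every contiguous factor of the word, the position of its
  maximal letter, and nothing else; the order ideal records which letters are at least as large as
  the first one. This is expressed by letter substitutions: if \<open>\<phi>\<close> turns the word of \<open>w\<close> into that of
  \<open>w'\<close>, then \<open>beta w' = beta w\<close> holds iff \<open>\<phi>\<close> commutes with the maximum of each factor of \<open>w\<close> and
  respects comparisons with the first letter (\<open>beta_eq_relabel_iff\<close>).

  The permutations in the product of \<open>F w\<close> and \<open>F v\<close>, where \<open>w\<close> has \<open>n\<close> letters, are those whose
  letters up to \<open>n\<close> spell \<open>w\<close> and whose letters above \<open>n\<close> spell \<open>v\<close> shifted by \<open>n\<close>
  (\<open>bij_betw_shuffle\<close>). Every large letter exceeds every small one. Hence the maximum of a factor of
  such a shuffle is found among its large letters if there are any, and these form a factor of the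
  shifted \<open>v\<close>; the first letter is treated in the same way. So replacing the letters of \<open>w\<close> and \<open>v\<close>
  by those of equivalent permutations \<open>w'\<close> and \<open>v'\<close>, position by position, maps the shuffles of \<open>w\<close>
  and \<open>v\<close> bijectively to those of \<open>w'\<close> and \<open>v'\<close> without changing their bi-leveled trees
  (\<open>sum_beta_shuffles_cong\<close>). This is the independence of representatives.

  The same description of shuffles makes the product of permutations associative: both ways of
  bracketing three factors sum over the permutations whose small, middle and large letters spell
  the three words. All algebra laws then pass to bi-leveled trees along \<open>beta_lin\<close>, which is
  multiplicative by construction and surjective because every bi-leveled tree is the image of a
  permutation (\<open>surj_beta\<close>): label the nodes increasingly towards the root, first those outside the
  ideal, then the leftmost node, then the others.
\<close>

section \<open>Trees and maxima of contiguous factors\<close>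

text \<open>Standardization only relabels letters monotonically. Everything that is invariant under such
  relabellings may therefore be computed on raw words with distinct letters, without standardizing
  in between.\<close>

lemma standardize_eq_map:
  "standardize a = map (\<lambda>x. card {y \<in> set a. y \<le> x}) a"
  "strict_mono_on (set a) (\<lambda>x. card {y \<in> set a. y \<le> x})"
proof -
  show "strict_mono_on (set a) (\<lambda>x. card {y \<in> set a. y \<le> x})"
  proof (rule strict_mono_onI)
    fix r s assume "r \<in> set a" "s \<in> set a" "r < s"
    then have "s \<in> {y \<in> set a. y \<le> s} - {y \<in> set a. y \<le> r}"
      and "{y \<in> set a. y \<le> r} \<subseteq> {y \<in> set a. y \<le> s}" by auto
    then have "{y \<in> set a. y \<le> r} \<subset> {y \<in> set a. y \<le> s}" by blast
    then show "card {y \<in> set a. y \<le> r} < card {y \<in> set a. y \<le> s}"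
      by (intro psubset_card_mono) auto
  qed
qed (simp add: standardize_def)

lemma standardize_map:
  assumes "strict_mono_on (set a) f"
  shows "standardize (map f a) = standardize a"
proof -
  have "card {y \<in> f ` set a. y \<le> f x} = card {y \<in> set a. y \<le> x}" if "x \<in> set a" for x
  proof -
    have "{y \<in> f ` set a. y \<le> f x} = f ` {y \<in> set a. y \<le> x}"
      using that strict_mono_on_leD[OF assms] strict_mono_onD[OF assms]
      by (auto simp: image_iff) (metis linorder_not_le)
    moreover have "inj_on f {y \<in> set a. y \<le> x}"
      using strict_mono_on_imp_inj_on[OF assms] by (rule inj_on_subset) auto
    ultimately show ?thesis by (simp add: card_image)
  qed
  then show ?thesis by (simp add: standardize_def)
qed

lemma tau_unfold:
  "w \<noteq> [] \<Longrightarrow> tau w =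
     tau (standardize (takeWhile (\<lambda>x. x \<noteq> Max (set w)) w)) \<or>\<^sub>t
     tau (standardize (tl (dropWhile (\<lambda>x. x \<noteq> Max (set w)) w)))"
  by (cases w) (simp_all only: tau.simps list.distinct not_False_eq_True simp_thms)

text \<open>No induction is needed: relabelling by \<open>f\<close> commutes with cutting a word at its maximal
  letter, and the two pieces to which the recursion of \<open>tau\<close> is applied are standardized, so that
  they do not change at all.\<close>

lemma tau_map:
  assumes f: "strict_mono_on (set w) f"
  shows "tau (map f w) = tau w"
proof (cases "w = []")
  case False
  let ?M = "Max (set w)"
  have M: "?M \<in> set w" using False by simp
  have Max_f: "Max (set (map f w)) = f ?M"
    using M strict_mono_on_leD[OF f _ M] by (intro Max_eqI) auto
  have ne: "f x \<noteq> f ?M \<longleftrightarrow> x \<noteq> ?M" if "x \<in> set w" for x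
    using strict_mono_on_imp_inj_on[OF f] that M by (auto dest: inj_onD)
  have take_eq: "takeWhile (\<lambda>x. x \<noteq> f ?M) (map f w) = map f (takeWhile (\<lambda>x. x \<noteq> ?M) w)"
    using ne by (auto simp: takeWhile_map o_def intro!: arg_cong[of _ _ "map f"] takeWhile_cong)
  have drop_eq: "tl (dropWhile (\<lambda>x. x \<noteq> f ?M) (map f w))
      = map f (tl (dropWhile (\<lambda>x. x \<noteq> ?M) w))"
    using ne by (auto simp: dropWhile_map o_def map_tl
        intro!: arg_cong[of _ _ "map f"] arg_cong[of _ _ tl] dropWhile_cong)
  have "set (takeWhile (\<lambda>x. x \<noteq> ?M) w) \<subseteq> set w"
    "set (tl (dropWhile (\<lambda>x. x \<noteq> ?M) w)) \<subseteq> set w"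
    by (auto dest: set_takeWhileD set_dropWhileD list.set_sel(2)[rotated])
      (metis list.sel(2) list.set_sel(2) set_dropWhileD)
  then have "strict_mono_on (set (takeWhile (\<lambda>x. x \<noteq> ?M) w)) f"
    "strict_mono_on (set (tl (dropWhile (\<lambda>x. x \<noteq> ?M) w))) f"
    by (simp_all add: monotone_on_subset[OF f])
  then show ?thesis
    using False by (simp add: tau_unfold Max_f[simplified] take_eq drop_eq standardize_map)
qed simp

lemma tau_standardize: "tau (standardize a) = tau a"
  using tau_map[OF standardize_eq_map(2)] standardize_eq_map(1) by metis

text \<open>The recursion of \<open>tau\<close> freed from standardization.\<close>

lemma tau_split:
  assumes "\<And>x. x \<in> set a \<union> set b \<Longrightarrow> x < M"
  shows "tau (a @ M # b) = tau a \<or>\<^sub>t tau b"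
proof -
  have Max: "Max (set (a @ M # b)) = M"
    using assms by (intro Max_eqI) (auto intro: less_imp_le)
  have "takeWhile (\<lambda>x. x \<noteq> M) (a @ M # b) = a" "dropWhile (\<lambda>x. x \<noteq> M) (a @ M # b) = M # b"
    using assms by (auto simp: takeWhile_append dropWhile_append)
  with Max show ?thesis
    using tau_unfold[of "a @ M # b"] by (simp only: tau_standardize) (simp add: tau_standardize)
qed

lemma split_at_max:
  fixes w :: "nat list"
  assumes "distinct w" "w \<noteq> []"
  obtains a M b where "w = a @ M # b" "\<And>x. x \<in> set a \<union> set b \<Longrightarrow> x < M"
proof -
  obtain a M b where w: "w = a @ M # b" and M: "M = Max (set w)"
    using split_at_Max[OF assms(2)] by blast
  have "x < M" if "x \<in> set a \<union> set b" for x
  proof -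
    have "x \<le> M" unfolding M by (rule Max_ge) (use that w in auto)
    moreover have "x \<noteq> M" using that w assms(1) by auto
    ultimately show ?thesis by simp
  qed
  with w that show thesis by blast
qed

text \<open>An injective relabelling with this property preserves the position of the maximum in every contiguous
  factor of the word. This is exactly the information that the tree of a word retains.\<close>

definition preserves_factor_max :: "(nat \<Rightarrow> nat) \<Rightarrow> nat list \<Rightarrow> bool" where
  "preserves_factor_max \<phi> w \<longleftrightarrow>
     (\<forall>q. sublist q w \<longrightarrow> q \<noteq> [] \<longrightarrow> Max (\<phi> ` set q) = \<phi> (Max (set q)))"

text \<open>A contiguous factor cannot straddle a letter without containing it.\<close>

lemma sublist_avoiding_letter:
  "sublist q (a @ M # b) \<Longrightarrow> M \<notin> set q \<Longrightarrow> sublist q a \<or> sublist q b"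
  by (auto simp: sublist_append sublist_Cons_right prefix_Cons)

lemma preserves_factor_max_sublist:
  "preserves_factor_max \<phi> w \<Longrightarrow> sublist u w \<Longrightarrow> preserves_factor_max \<phi> u"
  unfolding preserves_factor_max_def by (meson sublist_order.order.trans)

text \<open>If the trees agree, their root splits agree, so the maximal letter keeps its position and the two
  halves have equal trees; a factor either contains that letter, which is then its maximum before
  and after the relabelling, or lies in one of the halves. Conversely, applying the hypothesis to
  the whole word shows that the maximum stays in place, and the halves inherit the hypothesis.\<close>

theorem tau_map_eq_iff:
  assumes "distinct w" "distinct (map \<phi> w)"
  shows "tau (map \<phi> w) = tau w \<longleftrightarrow> preserves_factor_max \<phi> w"
  using assms
proof (induction w rule: length_induct)
  case (1 w)
  show ?case
  proof (cases "w = []")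
    case True
    then show ?thesis by (auto simp: preserves_factor_max_def)
  next
    case False
    then obtain a M b where w: "w = a @ M # b" and M: "\<And>x. x \<in> set a \<union> set b \<Longrightarrow> x < M"
      using split_at_max 1(2) by blast
    have IH: "tau (map \<phi> a) = tau a \<longleftrightarrow> preserves_factor_max \<phi> a"
      "tau (map \<phi> b) = tau b \<longleftrightarrow> preserves_factor_max \<phi> b"
      using 1 w by simp_all
    have tau_w: "tau w = tau a \<or>\<^sub>t tau b"
      unfolding w using M by (rule tau_split)
    show ?thesis
    proof
      assume eq: "tau (map \<phi> w) = tau w"
      obtain a' M' b' where w': "map \<phi> w = a' @ M' # b'"
        and M': "\<And>x. x \<in> set a' \<union> set b' \<Longrightarrow> x < M'"
        using split_at_max[of "map \<phi> w"] 1(3) False by auto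
      have "tau (map \<phi> w) = tau a' \<or>\<^sub>t tau b'"
        unfolding w' using M' by (rule tau_split)
      with eq tau_w have sub: "tau a' = tau a" "tau b' = tau b" by simp_all
      \<comment> \<open>The left subtree has one node per letter, so equal trees force equal cut positions.\<close>
      then have "length a' = length (map \<phi> a)"
        using size_tau by (metis length_map)
      then have parts: "a' = map \<phi> a" "M' = \<phi> M" "b' = map \<phi> b"
        using w' unfolding w by simp_all
      then have pres: "preserves_factor_max \<phi> a" "preserves_factor_max \<phi> b"
        using IH sub by simp_all
      show "preserves_factor_max \<phi> w"
        unfolding preserves_factor_max_def
      proof (intro allI impI)
        fix q assume q: "sublist q w" "q \<noteq> []"
        show "Max (\<phi> ` set q) = \<phi> (Max (set q))"
        proof (cases "M \<in> set q")
          case True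
          have sub: "set q \<subseteq> set w" using q(1) by (rule set_mono_sublist)
          have "Max (set q) = M"
            using True sub M by (intro Max_eqI) (auto simp: w intro: less_imp_le)
          moreover have "Max (\<phi> ` set q) = \<phi> M"
          proof (rule Max_eqI)
            fix y assume "y \<in> \<phi> ` set q"
            then obtain x where x: "x \<in> set q" "y = \<phi> x" by blast
            then have "x = M \<or> x \<in> set a \<union> set b" using sub w by auto
            then show "y \<le> \<phi> M"
              using M'[of "\<phi> x"] unfolding x(2) parts by auto
          qed (use True in auto)
          ultimately show ?thesis by simp
        next
          case False
          then show ?thesis
            using sublist_avoiding_letter[OF q(1)[unfolded w]] q(2) pres
            unfolding preserves_factor_max_def by blast
        qed
      qed
    next
      assume pres: "preserves_factor_max \<phi> w"
      have "sublist a w" "sublist b w"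
        unfolding w by (simp_all add: sublist_append sublist_Cons_right)
      then have eqs: "tau (map \<phi> a) = tau a" "tau (map \<phi> b) = tau b"
        using IH preserves_factor_max_sublist[OF pres] by simp_all
      have "Max (set w) = M"
        using M by (intro Max_eqI) (auto simp: w intro: less_imp_le)
      then have Max_eq: "Max (\<phi> ` set w) = \<phi> M"
        using pres False by (auto simp: preserves_factor_max_def)
      have "\<phi> x < \<phi> M" if "x \<in> set a \<union> set b" for x
      proof -
        have "\<phi> x \<le> \<phi> M"
          unfolding Max_eq[symmetric] by (rule Max_ge) (use that w in auto)
        moreover have "\<phi> x \<noteq> \<phi> M" using 1(3) that unfolding w by (auto simp: image_iff)
        ultimately show ?thesis by simp
      qed
      then have "tau (map \<phi> a @ \<phi> M # map \<phi> b) = tau (map \<phi> a) \<or>\<^sub>t tau (map \<phi> b)"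
        by (intro tau_split) auto
      then show "tau (map \<phi> w) = tau w"
        using tau_w eqs by (simp add: w)
    qed
  qed
qed

section \<open>Shuffles as sets of permutations\<close>

lemma perm_word_props:
  "distinct (word_of w)" "set (word_of w) = {1..perm_size w}" "length (word_of w) = perm_size w"
  using word_of_perm[of w] by (simp_all add: is_perm_word_def perm_size_def)

lemma word_of_Perm: "is_perm_word w \<Longrightarrow> word_of (Perm w) = w"
  by (rule Perm_inverse) simp

text \<open>The permutations that occur in the product of \<open>F w\<close> and \<open>F v\<close>, characterized without cuts: the
  small letters spell \<open>w\<close>, the large letters spell the shifted \<open>v\<close>.\<close>

definition shuffles_of :: "perm_word \<Rightarrow> perm_word \<Rightarrow> perm_word set" where
  "shuffles_of w v = {u.
     filter (\<lambda>a. a \<le> perm_size w) (word_of u) = word_of w \<and>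
     filter (\<lambda>a. perm_size w < a) (word_of u) = map ((+) (perm_size w)) (word_of v)}"

text \<open>The word that a shuffle builds, with the first cut position \<open>i\<close> left free, so that inductions
  over the remaining cuts go through; the case of interest is \<open>i = 0\<close>.\<close>

definition interleave :: "nat list \<Rightarrow> nat \<Rightarrow> nat list \<Rightarrow> nat \<Rightarrow> nat list \<Rightarrow> nat list" where
  "interleave w i is n v =
     insert_letters n (map2 (\<lambda>i j. drop i (take j w)) (i # is) (is @ [length w])) v"

lemma interleave_Nil [simp]: "interleave w i [] n [] = drop i w"
  by (simp add: interleave_def insert_letters_def)

lemma interleave_Cons [simp]:
  "interleave w i (j # js) n (a # v) = drop i (take j w) @ (n + a) # interleave w j js n v"
  by (cases js) (simp_all add: interleave_def insert_letters_def)

lemma filter_interleave: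
  assumes "length is = length v" "sorted (i # is)" "set (i # is) \<subseteq> {..length w}"
    and "\<And>a. a \<in> set w \<Longrightarrow> a \<le> n" "\<And>a. a \<in> set v \<Longrightarrow> 0 < a"
  shows "filter (\<lambda>a. a \<le> n) (interleave w i is n v) = drop i w
       \<and> filter (\<lambda>a. n < a) (interleave w i is n v) = map ((+) n) v"
  using assms
proof (induction "is" v arbitrary: i rule: list_induct2)
  case Nil
  then show ?case by (auto simp: filter_id_conv filter_empty_conv not_less dest: in_set_dropD)
next
  case (Cons j js a v)
  have low: "filter (\<lambda>a. a \<le> n) (drop i (take j w)) = drop i (take j w)"
    "filter (\<lambda>a. n < a) (drop i (take j w)) = []"
    using Cons.prems(3)
    by (auto simp: filter_id_conv filter_empty_conv not_less dest!: in_set_dropD in_set_takeD)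
  have "drop i (take j w) @ drop j w = drop i w"
    using Cons.prems drop_append[of i "take j w" "drop j w"] by simp
  moreover have "filter (\<lambda>a. a \<le> n) (interleave w j js n v) = drop j w
       \<and> filter (\<lambda>a. n < a) (interleave w j js n v) = map ((+) n) v"
    by (rule Cons.IH) (use Cons.prems in auto)
  ultimately show ?case using low Cons.prems(4)[of a] by simp
qed

text \<open>The cuts can be read off from the word: the first cut is the number of small letters in front of
  the first large letter, and the rest of the word determines the other cuts in the same way.\<close>

lemma ex1_interleave:
  assumes "filter (\<lambda>a. a \<le> n) x = drop i w" "filter (\<lambda>a. n < a) x = map ((+) n) v"
    and "i \<le> length w" "\<And>a. a \<in> set w \<Longrightarrow> a \<le> n"
  shows "\<exists>!is. length is = length v \<and> sorted (i # is) \<and> set (i # is) \<subseteq> {..length w}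
    \<and> interleave w i is n v = x"
  using assms
proof (induction v arbitrary: i x)
  case Nil
  then have "\<forall>a\<in>set x. a \<le> n" by (simp add: filter_empty_conv not_less)
  then have "x = drop i w" using Nil.prems(1) by (simp add: filter_id_conv[THEN iffD2])
  then show ?case using Nil.prems(3) by auto
next
  case (Cons a v)
  obtain p y where x: "x = p @ (n + a) # y" and p: "\<forall>b\<in>set p. b \<le> n"
    and a: "n < n + a" and y: "filter (\<lambda>a. n < a) y = map ((+) n) v"
    using Cons.prems(2) by (auto simp: filter_eq_Cons_iff not_less)
  \<comment> \<open>The position in \<open>w\<close> that is reached when the first large letter is inserted.\<close>
  define j where "j = i + length p"
  have py: "p @ filter (\<lambda>a. a \<le> n) y = drop i w"
    using Cons.prems(1) p a unfolding x by (simp add: filter_id_conv[THEN iffD2])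
  then have "length p \<le> length w - i" by (metis length_append length_drop le_add1)
  then have j: "j \<le> length w" "i \<le> j" using Cons.prems(3) by (auto simp: j_def)
  have p_eq: "p = drop i (take j w)"
    using arg_cong[OF py, of "take (length p)"] by (simp add: j_def take_drop add.commute)
  have "filter (\<lambda>a. a \<le> n) y = drop j w"
    using arg_cong[OF py, of "drop (length p)"] by (simp add: j_def add.commute)
  from Cons.IH[OF this y j(1) Cons.prems(4)] obtain js where js:
    "length js = length v" "sorted (j # js)" "set (j # js) \<subseteq> {..length w}" "interleave w j js n v = y"
    and uniq: "\<And>ks. length ks = length v \<and> sorted (j # ks) \<and> set (j # ks) \<subseteq> {..length w}
       \<and> interleave w j ks n v = y \<Longrightarrow> ks = js"
    by blast
  show ?case
  proof (rule ex1I[of _ "j # js"])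
    show "length (j # js) = length (a # v) \<and> sorted (i # j # js)
        \<and> set (i # j # js) \<subseteq> {..length w} \<and> interleave w i (j # js) n (a # v) = x"
      using js j x p_eq by auto
  next
    fix ks assume ks: "length ks = length (a # v) \<and> sorted (i # ks)
        \<and> set (i # ks) \<subseteq> {..length w} \<and> interleave w i ks n (a # v) = x"
    then obtain k ks' where [simp]: "ks = k # ks'" by (cases ks) auto
    have k: "i \<le> k" "k \<le> length w" using ks by auto
    have eq: "drop i (take k w) @ (n + a) # interleave w k ks' n v = p @ (n + a) # y"
      using ks x by simp
    have low: "\<forall>b\<in>set (drop i (take k w)). b \<le> n"
      using Cons.prems(4) by (auto dest!: in_set_dropD in_set_takeD)
    have "takeWhile (\<lambda>b. b \<le> n) (drop i (take k w) @ (n + a) # interleave w k ks' n v)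
        = drop i (take k w)"
      and "takeWhile (\<lambda>b. b \<le> n) (p @ (n + a) # y) = p"
      using low p a by (simp_all add: takeWhile_append)
    \<comment> \<open>Both sides start with the small letters that precede the first large one.\<close>
    then have pk: "drop i (take k w) = p" using eq by simp
    then have "k = j" using k by (auto simp: j_def)
    moreover have "interleave w k ks' n v = y" using eq pk by simp
    ultimately show "ks = j # js" using uniq[of ks'] ks by auto
  qed
qed

lemma word_of_shuffle_interleave:
  "is \<in> cuts (perm_size w) (perm_size v) \<Longrightarrow>
     word_of (shuffle w v is) = interleave (word_of w) 0 is (perm_size w) (word_of v)"
  by (simp add: word_of_shuffle cut_word_def interleave_def)

text \<open>Thus the sum over cuts in the Malvenuto-Reutenauer product is a sum over a set of permutations
  described by filters, which are much easier to iterate and to relabel.\<close>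

theorem bij_betw_shuffle:
  "bij_betw (shuffle w v) (cuts (perm_size w) (perm_size v)) (shuffles_of w v)"
proof -
  let ?n = "perm_size w"
  let ?C = "cuts ?n (perm_size v)"
  have cuts_iff: "is \<in> ?C \<longleftrightarrow> length is = length (word_of v) \<and> sorted (0 # is)
      \<and> set (0 # is) \<subseteq> {..length (word_of w)}" for "is"
    by (auto simp: cuts_def perm_size_def)
  have low: "a \<le> ?n" if "a \<in> set (word_of w)" for a
    using that by (simp add: perm_word_props)
  have pos: "0 < a" if "a \<in> set (word_of v)" for a
    using that by (simp add: perm_word_props)
  have ex1: "\<exists>!is. is \<in> ?C \<and> shuffle w v is = u" if "u \<in> shuffles_of w v" for u
  proof -
    have "shuffle w v is = u \<longleftrightarrow> interleave (word_of w) 0 is ?n (word_of v) = word_of u"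
      if "is \<in> ?C" for "is"
      using word_of_shuffle_interleave[OF that] by (metis word_of_inject)
    moreover have "\<exists>!is. is \<in> ?C \<and> interleave (word_of w) 0 is ?n (word_of v) = word_of u"
      using that ex1_interleave[of ?n "word_of u" 0 "word_of w" "word_of v"] low
      unfolding cuts_iff by (simp add: shuffles_of_def)
    ultimately show ?thesis by metis
  qed
  have into: "shuffle w v is \<in> shuffles_of w v" if "is \<in> ?C" for "is"
    using that filter_interleave[of "is" "word_of v" 0 "word_of w" ?n] low pos
    unfolding shuffles_of_def by (simp add: word_of_shuffle_interleave cuts_iff[of "is"])
  show ?thesis
    unfolding bij_betw_def inj_on_def using ex1 into by blast
qed

lemma finite_cuts: "finite (cuts n m)"
  by (rule finite_subset[OF _ finite_lists_length_eq[of "{0..n}" m]]) (auto simp: cuts_def)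

lemma finite_shuffles_of: "finite (shuffles_of w v)"
  using bij_betw_finite[OF bij_betw_shuffle] finite_cuts by blast

section \<open>Iterated shuffles\<close>

lemma perm_size_shuffles_of:
  assumes "u \<in> shuffles_of w v"
  shows "perm_size u = perm_size w + perm_size v"
proof -
  have "length (filter (\<lambda>a. a \<le> perm_size w) (word_of u))
      + length (filter (\<lambda>a. \<not> a \<le> perm_size w) (word_of u)) = length (word_of u)"
    by (rule sum_length_filter_compl)
  then show ?thesis
    using assms by (simp add: shuffles_of_def perm_size_def not_le)
qed

text \<open>Restricting a permutation to an initial or to a final interval of letters gives a permutation
  again, after a shift in the second case. This provides the intermediate factors for
  associativity.\<close>

lemma is_perm_word_low:
  assumes "is_perm_word x" "n \<le> length x"
  shows "is_perm_word (filter (\<lambda>a. a \<le> n) x) \<and> length (filter (\<lambda>a. a \<le> n) x) = n"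
proof -
  have "set (filter (\<lambda>a. a \<le> n) x) = {1..n}" "distinct (filter (\<lambda>a. a \<le> n) x)"
    using assms by (auto simp: is_perm_word_def)
  moreover from this have "length (filter (\<lambda>a. a \<le> n) x) = n"
    using distinct_card by fastforce
  ultimately show ?thesis by (simp add: is_perm_word_def)
qed

lemma is_perm_word_high:
  assumes "is_perm_word x" "n \<le> length x"
  shows "is_perm_word (map (\<lambda>a. a - n) (filter (\<lambda>a. n < a) x))
       \<and> length (filter (\<lambda>a. n < a) x) = length x - n"
proof -
  let ?y = "map (\<lambda>a. a - n) (filter (\<lambda>a. n < a) x)"
  have "set (filter (\<lambda>a. n < a) x) = {n+1..length x}"
    using assms by (auto simp: is_perm_word_def)
  moreover have "(\<lambda>a. a - n) ` {n+1..length x} = {1..length x - n}"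
  proof -
    have "{n+1..length x} = (+) n ` {1..length x - n}" using assms(2) by simp
    then show ?thesis by (simp only: image_image) simp
  qed
  ultimately have set: "set ?y = {1..length x - n}" by simp
  have dist: "distinct ?y"
    using assms by (auto simp: is_perm_word_def distinct_map inj_on_def)
  have "length ?y = length x - n"
    using distinct_card[OF dist] set by simp
  with set dist show ?thesis by (simp add: is_perm_word_def)
qed

lemma map_add_map_diff:
  "(\<And>a. a \<in> set xs \<Longrightarrow> n \<le> a) \<Longrightarrow> map ((+) n) (map (\<lambda>a. a - n) xs) = (xs :: nat list)"
  by (induction xs) auto

text \<open>The common value of both ways of multiplying three factors: small, middle and large letters spell
  the three given words.\<close>

definition triple_shuffles :: "perm_word \<Rightarrow> perm_word \<Rightarrow> perm_word \<Rightarrow> perm_word set" where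
  "triple_shuffles w v z = (let n = perm_size w; m = perm_size v in {x.
     filter (\<lambda>a. a \<le> n) (word_of x) = word_of w \<and>
     filter (\<lambda>a. n < a \<and> a \<le> n + m) (word_of x) = map ((+) n) (word_of v) \<and>
     filter (\<lambda>a. n + m < a) (word_of x) = map ((+) (n + m)) (word_of z)})"

lemma length_triple_shuffles:
  assumes "x \<in> triple_shuffles w v z"
  shows "perm_size x = perm_size w + perm_size v + perm_size z"
proof -
  let ?n = "perm_size w" and ?m = "perm_size v" and ?x = "word_of x"
  have "length (filter (\<lambda>a. a \<le> ?n) ?x) + length (filter (\<lambda>a. \<not> a \<le> ?n) ?x) = length ?x"
    by (rule sum_length_filter_compl)
  moreover have "length (filter (\<lambda>a. a \<le> ?n + ?m) (filter (\<lambda>a. \<not> a \<le> ?n) ?x))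
      + length (filter (\<lambda>a. \<not> a \<le> ?n + ?m) (filter (\<lambda>a. \<not> a \<le> ?n) ?x))
      = length (filter (\<lambda>a. \<not> a \<le> ?n) ?x)"
    by (rule sum_length_filter_compl)
  moreover have "filter (\<lambda>a. a \<le> ?n + ?m) (filter (\<lambda>a. \<not> a \<le> ?n) ?x)
      = filter (\<lambda>a. ?n < a \<and> a \<le> ?n + ?m) ?x"
    "filter (\<lambda>a. \<not> a \<le> ?n + ?m) (filter (\<lambda>a. \<not> a \<le> ?n) ?x) = filter (\<lambda>a. ?n + ?m < a) ?x"
    by (auto simp: conj_commute not_le intro!: filter_cong)
  ultimately show ?thesis
    using assms by (simp add: triple_shuffles_def Let_def perm_size_def)
qed

lemma Union_shuffles_of_left: "(\<Union>u\<in>shuffles_of w v. shuffles_of u z) = triple_shuffles w v z"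
proof (intro equalityI subsetI)
  fix x assume "x \<in> (\<Union>u\<in>shuffles_of w v. shuffles_of u z)"
  then obtain u where u: "u \<in> shuffles_of w v" and x: "x \<in> shuffles_of u z" by blast
  let ?n = "perm_size w" and ?m = "perm_size v"
  have x': "filter (\<lambda>a. a \<le> ?n + ?m) (word_of x) = word_of u"
    "filter (\<lambda>a. ?n + ?m < a) (word_of x) = map ((+) (?n + ?m)) (word_of z)"
    using x perm_size_shuffles_of[OF u] by (simp_all add: shuffles_of_def)
  have "filter (\<lambda>a. a \<le> ?n) (word_of u) = word_of w"
    "filter (\<lambda>a. ?n < a) (word_of u) = map ((+) ?n) (word_of v)"
    using u by (simp_all add: shuffles_of_def)
  moreover have "filter (\<lambda>a. a \<le> ?n) (word_of u) = filter (\<lambda>a. a \<le> ?n) (word_of x)"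
    "filter (\<lambda>a. ?n < a) (word_of u) = filter (\<lambda>a. ?n < a \<and> a \<le> ?n + ?m) (word_of x)"
    unfolding x'(1)[symmetric] by (auto simp: conj_commute intro!: filter_cong)
  ultimately show "x \<in> triple_shuffles w v z"
    using x' by (simp add: triple_shuffles_def Let_def)
next
  fix x assume x: "x \<in> triple_shuffles w v z"
  let ?n = "perm_size w" and ?m = "perm_size v"
  define u where "u = Perm (filter (\<lambda>a. a \<le> ?n + ?m) (word_of x))"
  have "?n + ?m \<le> length (word_of x)"
    using length_triple_shuffles[OF x] by (simp add: perm_size_def)
  note low = is_perm_word_low[OF word_of_perm this]
  have word_u: "word_of u = filter (\<lambda>a. a \<le> ?n + ?m) (word_of x)"
    unfolding u_def using low by (simp add: word_of_Perm)
  have size_u: "perm_size u = ?n + ?m" using low by (simp add: perm_size_def[of u] word_u)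
  have "filter (\<lambda>a. a \<le> ?n) (word_of u) = filter (\<lambda>a. a \<le> ?n) (word_of x)"
    "filter (\<lambda>a. ?n < a) (word_of u) = filter (\<lambda>a. ?n < a \<and> a \<le> ?n + ?m) (word_of x)"
    unfolding word_u by (auto simp: conj_commute intro!: filter_cong)
  then have "u \<in> shuffles_of w v" "x \<in> shuffles_of u z"
    using x by (simp_all add: shuffles_of_def triple_shuffles_def Let_def size_u word_u)
  then show "x \<in> (\<Union>u\<in>shuffles_of w v. shuffles_of u z)" by blast
qed

lemma Union_shuffles_of_right: "(\<Union>y\<in>shuffles_of v z. shuffles_of w y) = triple_shuffles w v z"
proof (intro equalityI subsetI)
  fix x assume "x \<in> (\<Union>y\<in>shuffles_of v z. shuffles_of w y)"
  then obtain y where y: "y \<in> shuffles_of v z" and x: "x \<in> shuffles_of w y" by blast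
  let ?n = "perm_size w" and ?m = "perm_size v"
  have x': "filter (\<lambda>a. a \<le> ?n) (word_of x) = word_of w"
    "filter (\<lambda>a. ?n < a) (word_of x) = map ((+) ?n) (word_of y)"
    using x by (simp_all add: shuffles_of_def)
  have y': "filter (\<lambda>a. a \<le> ?m) (word_of y) = word_of v"
    "filter (\<lambda>a. ?m < a) (word_of y) = map ((+) ?m) (word_of z)"
    using y by (simp_all add: shuffles_of_def)
  have "filter (\<lambda>a. ?n < a \<and> a \<le> ?n + ?m) (word_of x)
      = filter (\<lambda>a. a \<le> ?n + ?m) (filter (\<lambda>a. ?n < a) (word_of x))"
    by (simp add: conj_commute)
  also have "\<dots> = map ((+) ?n) (filter (\<lambda>a. a \<le> ?m) (word_of y))"
    unfolding x'(2) by (simp add: filter_map o_def)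
  finally have mid: "filter (\<lambda>a. ?n < a \<and> a \<le> ?n + ?m) (word_of x) = map ((+) ?n) (word_of v)"
    using y' by simp
  have "filter (\<lambda>a. ?n + ?m < a) (word_of x)
      = filter (\<lambda>a. ?n + ?m < a) (filter (\<lambda>a. ?n < a) (word_of x))"
    by (auto intro!: filter_cong)
  also have "\<dots> = map ((+) ?n) (filter (\<lambda>a. ?m < a) (word_of y))"
    unfolding x'(2) by (simp add: filter_map o_def)
  finally have "filter (\<lambda>a. ?n + ?m < a) (word_of x) = map ((+) (?n + ?m)) (word_of z)"
    using y' by (simp add: o_def add.assoc)
  with mid x' show "x \<in> triple_shuffles w v z"
    by (simp add: triple_shuffles_def Let_def)
next
  fix x assume x: "x \<in> triple_shuffles w v z"
  let ?n = "perm_size w" and ?m = "perm_size v"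
  define y where "y = Perm (map (\<lambda>a. a - ?n) (filter (\<lambda>a. ?n < a) (word_of x)))"
  have "?n \<le> length (word_of x)"
    using length_triple_shuffles[OF x] by (simp add: perm_size_def)
  note high = is_perm_word_high[OF word_of_perm this]
  have word_y: "word_of y = map (\<lambda>a. a - ?n) (filter (\<lambda>a. ?n < a) (word_of x))"
    unfolding y_def using high by (simp add: word_of_Perm)
  have "filter (\<lambda>a. a \<le> ?m) (word_of y)
      = map (\<lambda>a. a - ?n) (filter (\<lambda>a. ?n < a \<and> a \<le> ?n + ?m) (word_of x))"
    unfolding word_y by (auto simp: filter_map o_def intro!: arg_cong[of _ _ "map _"] filter_cong)
  moreover have "filter (\<lambda>a. ?m < a) (word_of y)
      = map (\<lambda>a. a - ?n) (filter (\<lambda>a. ?n + ?m < a) (word_of x))"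
    unfolding word_y by (auto simp: filter_map o_def intro!: arg_cong[of _ _ "map _"] filter_cong)
  ultimately have "y \<in> shuffles_of v z"
    using x by (simp add: shuffles_of_def triple_shuffles_def Let_def o_def add.assoc)
  moreover have "x \<in> shuffles_of w y"
  proof -
    have "map ((+) ?n) (word_of y) = filter (\<lambda>a. ?n < a) (word_of x)"
      unfolding word_y by (rule map_add_map_diff) auto
    then show ?thesis using x by (simp add: shuffles_of_def triple_shuffles_def Let_def)
  qed
  ultimately show "x \<in> (\<Union>y\<in>shuffles_of v z. shuffles_of w y)" by blast
qed

text \<open>A shuffle determines each of its two factors, so the unions above are disjoint and no term of an
  iterated product is counted twice.\<close>

lemma disjoint_shuffles_of_left:
  assumes "u \<in> shuffles_of w v" "u' \<in> shuffles_of w v" "u \<noteq> u'"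
  shows "shuffles_of u z \<inter> shuffles_of u' z = {}"
  using assms perm_size_shuffles_of word_of_inject
  by (fastforce simp: shuffles_of_def[of _ z])

lemma disjoint_shuffles_of_right:
  assumes "y \<noteq> y'"
  shows "shuffles_of w y \<inter> shuffles_of w y' = {}"
proof -
  have "word_of y = word_of y'" if "x \<in> shuffles_of w y" "x \<in> shuffles_of w y'" for x
  proof -
    have "map ((+) (perm_size w)) (word_of y) = map ((+) (perm_size w)) (word_of y')"
      using that by (simp add: shuffles_of_def)
    then show ?thesis by (auto dest: map_injective simp: inj_def)
  qed
  with assms show ?thesis by (auto simp: word_of_inject)
qed

lemma shuffles_of_Nil_left: "shuffles_of (Perm []) v = {v}"
proof -
  have [simp]: "perm_size (Perm []) = 0" "word_of (Perm []) = []"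
    by (simp_all add: perm_size_def word_of_Perm_Nil)
  have 1: "filter (\<lambda>a. 0 < a) (word_of u) = word_of u" "filter (\<lambda>a. a = 0) (word_of u) = []" for u
    by (auto simp: filter_id_conv filter_empty_conv perm_word_props)
  show ?thesis
    by (auto simp: shuffles_of_def 1 word_of_inject map_idI)
qed

lemma shuffles_of_Nil_right: "shuffles_of w (Perm []) = {w}"
proof -
  have [simp]: "word_of (Perm []) = []" by (simp_all add: word_of_Perm_Nil)
  have 1: "filter (\<lambda>a. perm_size w < a) (word_of w) = []"
    "filter (\<lambda>a. a \<le> perm_size w) (word_of w) = word_of w"
    by (auto simp: filter_id_conv filter_empty_conv perm_word_props)
  have "u = w" if "filter (\<lambda>a. perm_size w < a) (word_of u) = []"
    "filter (\<lambda>a. a \<le> perm_size w) (word_of u) = word_of w" for u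
  proof -
    have "filter (\<lambda>a. a \<le> perm_size w) (word_of u) = word_of u"
      using that(1) by (auto simp: filter_id_conv filter_empty_conv)
    then show ?thesis using that(2) word_of_inject by metis
  qed
  with 1 show ?thesis by (auto simp: shuffles_of_def)
qed

section \<open>Replacing the factors of a shuffle\<close>

text \<open>The substitution that turns \<open>xs\<close> letter by letter into \<open>ys\<close>. It is meaningful only on the letters
  of \<open>xs\<close>, outside of which \<open>the\<close> is applied to \<open>None\<close>.\<close>

definition relabel :: "nat list \<Rightarrow> nat list \<Rightarrow> nat \<Rightarrow> nat" where
  "relabel xs ys a = the (map_of (zip xs ys) a)"

lemma map_relabel: "distinct xs \<Longrightarrow> length xs = length ys \<Longrightarrow> map (relabel xs ys) xs = ys"
  by (rule nth_equalityI) (simp_all add: relabel_def map_of_zip_nth)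

lemma relabel_inverse:
  assumes "distinct xs" "distinct ys" "length xs = length ys" "a \<in> set xs"
  shows "relabel ys xs (relabel xs ys a) = a"
proof -
  have "map (relabel ys xs \<circ> relabel xs ys) xs = xs"
    using assms by (simp flip: map_map add: map_relabel)
  then have "map (relabel ys xs \<circ> relabel xs ys) xs = map id xs" by simp
  then have "(relabel ys xs \<circ> relabel xs ys) a = id a"
    using assms(4) unfolding map_eq_conv by blast
  then show ?thesis by simp
qed

lemma sublist_filter: "sublist q w \<Longrightarrow> sublist (filter P q) (filter P w)"
  unfolding sublist_def by (elim exE, hypsubst, unfold filter_append) blast

lemma preserves_factor_max_map_add:
  assumes "preserves_factor_max \<psi> v" "\<And>a. a \<in> set v \<Longrightarrow> \<phi> (n + a) = n + \<psi> a"
  shows "preserves_factor_max \<phi> (map ((+) n) v)"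
  unfolding preserves_factor_max_def
proof (intro allI impI)
  fix q assume "sublist q (map ((+) n) v)" "q \<noteq> []"
  then obtain p where p: "q = map ((+) n) p" "sublist p v" "p \<noteq> []"
  proof -
    obtain ps ss where "map ((+) n) v = ps @ q @ ss"
      using \<open>sublist q (map ((+) n) v)\<close> by (auto simp: sublist_def)
    then obtain us vs where "v = us @ vs" "q @ ss = map ((+) n) vs"
      by (auto simp: map_eq_append_conv)
    moreover from this obtain p ws where "vs = p @ ws" "q = map ((+) n) p"
      by (auto simp: append_eq_map_conv)
    ultimately show thesis using that \<open>q \<noteq> []\<close> by (auto simp: sublist_def)
  qed
  have "set p \<subseteq> set v" using p(2) by (rule set_mono_sublist)
  then have "\<phi> ` set q = (+) n ` \<psi> ` set p"
    using assms(2) by (auto simp: p(1) image_image subset_iff intro!: image_cong)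
  moreover have "Max ((+) n ` A) = n + Max A" if "finite A" "A \<noteq> {}" for A
    using that mono_Max_commute[of "(+) n" A] by (simp add: mono_def)
  moreover have "Max (\<psi> ` set p) = \<psi> (Max (set p))"
    using assms(1) p by (simp add: preserves_factor_max_def)
  moreover have "Max (set p) \<in> set v" using \<open>set p \<subseteq> set v\<close> p(3) by auto
  ultimately show "Max (\<phi> ` set q) = \<phi> (Max (set q))"
    using p assms(2) by simp
qed

text \<open>If a factor of the shuffle contains a large letter, its maximum is the maximum of its large
  letters, and these form a factor of the subword of large letters. Otherwise the factor consists
  of small letters only and is itself a factor of the subword of small letters.\<close>

lemma preserves_factor_max_shuffle:
  assumes low: "preserves_factor_max \<phi> (filter (\<lambda>a. a \<le> n) u)"
    and high: "preserves_factor_max \<phi> (filter (\<lambda>a. n < a) u)"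
    and keep: "\<And>a. a \<in> set u \<Longrightarrow> \<phi> a \<le> n \<longleftrightarrow> a \<le> n"
  shows "preserves_factor_max \<phi> u"
  unfolding preserves_factor_max_def
proof (intro allI impI)
  fix q assume q: "sublist q u" "q \<noteq> []"
  have sub: "set q \<subseteq> set u" using q(1) by (rule set_mono_sublist)
  show "Max (\<phi> ` set q) = \<phi> (Max (set q))"
  proof (cases "filter (\<lambda>a. n < a) q = []")
    case True
    then have "filter (\<lambda>a. a \<le> n) q = q" by (auto simp: filter_empty_conv filter_id_conv not_less)
    then show ?thesis
      using low sublist_filter[OF q(1), of "\<lambda>a. a \<le> n"] q(2)
      by (simp add: preserves_factor_max_def)
  next
    case False
    define h where "h = filter (\<lambda>a. n < a) q"
    have h: "Max (\<phi> ` set h) = \<phi> (Max (set h))" "h \<noteq> []"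
      using high sublist_filter[OF q(1), of "\<lambda>a. n < a"] False
      unfolding h_def preserves_factor_max_def by blast+
    have Max_h: "Max (set h) \<in> set h" using h(2) by simp
    then have n: "Max (set h) \<in> set q" "n < Max (set h)" unfolding h_def by simp_all
    have "a \<le> Max (set h) \<and> \<phi> a \<le> \<phi> (Max (set h))" if "a \<in> set q" for a
    proof (cases "n < a")
      case True
      then have "a \<in> set h" using that by (simp add: h_def)
      then have "a \<le> Max (set h)" "\<phi> a \<le> Max (\<phi> ` set h)" by simp_all
      then show ?thesis by (simp add: h(1))
    next
      case False
      then have "\<phi> a \<le> n" using keep that sub by auto
      moreover have "n < \<phi> (Max (set h))" using keep[of "Max (set h)"] n sub by auto
      ultimately show ?thesis using False n(2) by linarith
    qed
    then have "Max (set q) = Max (set h)" "Max (\<phi> ` set q) = \<phi> (Max (set h))"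
      using n(1) by (auto intro!: Max_eqI)
    then show ?thesis by simp
  qed
qed

text \<open>The counterpart of \<^const>\<open>preserves_factor_max\<close> for the order ideal: \<open>upper_nodes\<close> records
  precisely which letters are at least as large as the first one.\<close>

definition preserves_first_order :: "(nat \<Rightarrow> nat) \<Rightarrow> nat list \<Rightarrow> bool" where
  "preserves_first_order \<phi> w \<longleftrightarrow> (\<forall>a\<in>set w. \<phi> (hd w) \<le> \<phi> a \<longleftrightarrow> hd w \<le> a)"

lemma upper_nodes_map_eq_iff:
  "upper_nodes (map \<phi> w) = upper_nodes w \<longleftrightarrow> preserves_first_order \<phi> w"
proof (cases "w = []")
  case False
  have mem: "i \<in> upper_nodes (map \<phi> w) \<longleftrightarrow> i \<in> {1..length w} \<and> \<phi> (hd w) \<le> \<phi> (w ! (i - 1))"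
    "i \<in> upper_nodes w \<longleftrightarrow> i \<in> {1..length w} \<and> hd w \<le> w ! (i - 1)" for i
    using False by (auto simp: upper_nodes_def hd_conv_nth)
  have "upper_nodes (map \<phi> w) = upper_nodes w \<longleftrightarrow>
      (\<forall>i\<in>{1..length w}. \<phi> (hd w) \<le> \<phi> (w ! (i - 1)) \<longleftrightarrow> hd w \<le> w ! (i - 1))"
    unfolding set_eq_iff mem by blast
  also have "\<dots> \<longleftrightarrow> (\<forall>k<length w. \<phi> (hd w) \<le> \<phi> (w ! k) \<longleftrightarrow> hd w \<le> w ! k)"
  proof -
    have "(\<forall>i\<in>{1..n}. P (i - 1)) \<longleftrightarrow> (\<forall>k<n. P k)" for n :: nat and P
    proof -
      have "{1..n} = Suc ` {..<n}" by (simp add: image_Suc_lessThan)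
      then show ?thesis by (simp only:) auto
    qed
    then show ?thesis .
  qed
  also have "\<dots> \<longleftrightarrow> preserves_first_order \<phi> w"
    by (simp add: preserves_first_order_def all_set_conv_all_nth)
  finally show ?thesis .
qed (auto simp: upper_nodes_def preserves_first_order_def)

text \<open>The first letter of a shuffle is the first letter of its small or of its large subword; letters of
  the same kind are compared within that subword, and letters of different kinds compare in the
  same way before and after the relabelling.\<close>

lemma preserves_first_order_shuffle:
  assumes low: "preserves_first_order \<phi> (filter (\<lambda>a. a \<le> n) u)"
    and high: "preserves_first_order \<phi> (filter (\<lambda>a. n < a) u)"
    and keep: "\<And>a. a \<in> set u \<Longrightarrow> \<phi> a \<le> n \<longleftrightarrow> a \<le> n"
  shows "preserves_first_order \<phi> u"
proof (cases u)
  case (Cons h t)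
  show ?thesis
    unfolding preserves_first_order_def
  proof
    fix a assume a: "a \<in> set u"
    show "\<phi> (hd u) \<le> \<phi> a \<longleftrightarrow> hd u \<le> a"
      using low high a keep[of h] keep[OF a] unfolding Cons preserves_first_order_def
      by (cases "h \<le> n"; cases "a \<le> n") auto
  qed
qed (simp add: preserves_first_order_def)

theorem beta_eq_relabel_iff:
  assumes "word_of w' = map \<phi> (word_of w)"
  shows "beta w' = beta w \<longleftrightarrow>
    preserves_factor_max \<phi> (word_of w) \<and> preserves_first_order \<phi> (word_of w)"
proof -
  have "distinct (map \<phi> (word_of w))" using perm_word_props(1)[of w'] assms by simp
  then show ?thesis
    using tau_map_eq_iff[OF perm_word_props(1)] upper_nodes_map_eq_iff
    by (simp add: pair_of_inject[symmetric] pair_of_beta assms)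
qed

text \<open>The letter substitution that carries shuffles of \<open>w\<close> and \<open>v\<close> to shuffles of \<open>w'\<close> and \<open>v'\<close> with
  the same pattern of small and large positions.\<close>

definition relabel_shuffle ::
    "perm_word \<Rightarrow> perm_word \<Rightarrow> perm_word \<Rightarrow> perm_word \<Rightarrow> nat \<Rightarrow> nat" where
  "relabel_shuffle w v w' v' =
     relabel (word_of w @ map ((+) (perm_size w)) (word_of v))
       (word_of w' @ map ((+) (perm_size w')) (word_of v'))"

lemma distinct_concat_word: "distinct (word_of w @ map ((+) (perm_size w)) (word_of v))"
  by (auto simp: perm_word_props distinct_map)

lemma set_concat_word:
  "set (word_of w @ map ((+) (perm_size w)) (word_of v)) = {1..perm_size w + perm_size v}"
proof -
  have "(+) (perm_size w) ` {1..perm_size v} = {perm_size w + 1..perm_size w + perm_size v}"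
    by simp
  then show ?thesis by (auto simp: perm_word_props simp del: image_add_atLeastAtMost)
qed

lemma relabel_shuffle_inverse:
  assumes "perm_size w' = perm_size w" "perm_size v' = perm_size v"
    and "a \<in> {1..perm_size w + perm_size v}"
  shows "relabel_shuffle w' v' w v (relabel_shuffle w v w' v' a) = a"
  unfolding relabel_shuffle_def
  by (rule relabel_inverse[OF distinct_concat_word distinct_concat_word])
    (use assms in \<open>simp_all add: set_concat_word perm_word_props(3) del: set_append\<close>)

lemma map_relabel_shuffle:
  assumes "perm_size w' = perm_size w" "perm_size v' = perm_size v"
  shows "map (relabel_shuffle w v w' v') (word_of w) = word_of w'"
    "map (relabel_shuffle w v w' v') (map ((+) (perm_size w)) (word_of v))
      = map ((+) (perm_size w)) (word_of v')"
    "relabel_shuffle w v w' v' ` {1..perm_size w + perm_size v} = {1..perm_size w + perm_size v}"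
proof -
  let ?f = "relabel_shuffle w v w' v'"
  have eq: "map ?f (word_of w @ map ((+) (perm_size w)) (word_of v))
      = word_of w' @ map ((+) (perm_size w)) (word_of v')"
    unfolding relabel_shuffle_def
    by (subst map_relabel[OF distinct_concat_word]) (use assms in \<open>simp_all add: perm_word_props(3)\<close>)
  show "map ?f (word_of w) = word_of w'"
    "map ?f (map ((+) (perm_size w)) (word_of v)) = map ((+) (perm_size w)) (word_of v')"
    using eq assms(1) unfolding map_append
    by (auto simp: append_eq_append_conv perm_word_props(3) simp del: map_map)
  show "?f ` {1..perm_size w + perm_size v} = {1..perm_size w + perm_size v}"
    using arg_cong[OF eq, of set] set_concat_word[of w' v', unfolded assms]
    by (simp only: set_map set_concat_word)
qed

text \<open>The heart of the well-definedness: substituting equivalent factors inside a shuffle does not change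
  its bi-leveled tree, because both properties that characterize equality of bi-leveled trees pass
  from the two factors to the shuffle.\<close>

lemma relabel_shuffles_of:
  assumes b: "beta w = beta w'" "beta v = beta v'"
    and size: "perm_size w' = perm_size w" "perm_size v' = perm_size v"
    and u: "u \<in> shuffles_of w v"
  defines "u' \<equiv> Perm (map (relabel_shuffle w v w' v') (word_of u))"
  shows "word_of u' = map (relabel_shuffle w v w' v') (word_of u)"
    and "u' \<in> shuffles_of w' v'"
    and "beta u' = beta u"
proof -
  let ?f = "relabel_shuffle w v w' v'" and ?n = "perm_size w" and ?m = "perm_size v"
  note maps = map_relabel_shuffle[OF size]
  have low: "filter (\<lambda>a. a \<le> ?n) (word_of u) = word_of w"
    and high: "filter (\<lambda>a. ?n < a) (word_of u) = map ((+) ?n) (word_of v)"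
    using u by (simp_all add: shuffles_of_def)
  have set_u: "set (word_of u) = {1..?n + ?m}"
    using perm_size_shuffles_of[OF u] by (simp add: perm_word_props)
  have inj: "inj_on ?f {1..?n + ?m}"
    by (rule inj_on_inverseI[where g = "relabel_shuffle w' v' w v"])
      (rule relabel_shuffle_inverse[OF size])
  have "is_perm_word (map ?f (word_of u))"
    unfolding is_perm_word_def using perm_size_shuffles_of[OF u] inj maps(3)
    by (simp add: distinct_map perm_word_props(1,3) set_u)
  then show word: "word_of u' = map ?f (word_of u)"
    unfolding u'_def by (rule word_of_Perm)
  have keep: "?f a \<le> ?n \<longleftrightarrow> a \<le> ?n" if "a \<in> set (word_of u)" for a
  proof (cases "a \<le> ?n")
    case True
    then have "a \<in> set (word_of w)" using that set_u by (simp add: perm_word_props)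
    then have "?f a \<in> set (word_of w')" unfolding maps(1)[symmetric] by simp
    then show ?thesis using True size by (simp add: perm_word_props)
  next
    case False
    then have "a \<in> set (map ((+) ?n) (word_of v))" using that unfolding high[symmetric] by simp
    then have "?f a \<in> set (map ((+) ?n) (word_of v'))"
      unfolding maps(2)[symmetric] by (simp only: set_map[of ?f] imageI)
    then have "?n < ?f a" by (auto simp: perm_word_props)
    then show ?thesis using False by simp
  qed
  have "filter (\<lambda>a. a \<le> ?n) (map ?f (word_of u)) = map ?f (filter (\<lambda>a. a \<le> ?n) (word_of u))"
    using keep by (auto simp: filter_map intro!: arg_cong[of _ _ "map ?f"] filter_cong)
  moreover have "filter (\<lambda>a. ?n < a) (map ?f (word_of u)) = map ?f (filter (\<lambda>a. ?n < a) (word_of u))"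
    using keep by (auto simp: filter_map not_le[symmetric]
        intro!: arg_cong[of _ _ "map ?f"] filter_cong)
  ultimately show "u' \<in> shuffles_of w' v'"
    unfolding shuffles_of_def mem_Collect_eq word size low high maps(1,2) by simp
  have pw: "preserves_factor_max ?f (word_of w)" "preserves_first_order ?f (word_of w)"
    using beta_eq_relabel_iff[OF maps(1)[symmetric]] b by simp_all
  \<comment> \<open>The substitution on large letters, shifted back to the letters of \<open>v\<close>.\<close>
  define g where "g a = ?f (?n + a) - ?n" for a
  have fg: "?f (?n + a) = ?n + g a" if "a \<in> set (word_of v)" for a
  proof -
    have "?f (?n + a) \<in> set (map ((+) ?n) (word_of v'))"
      unfolding maps(2)[symmetric] using that by (auto simp: image_iff)
    then show ?thesis by (auto simp: g_def)
  qed
  have "map ((+) ?n) (map g (word_of v)) = map ((+) ?n) (word_of v')"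
    unfolding maps(2)[symmetric] using fg by simp
  then have "map g (word_of v) = word_of v'"
    by (auto dest: map_injective simp: inj_def simp del: map_map)
  then have pv: "preserves_factor_max g (word_of v)" "preserves_first_order g (word_of v)"
    using beta_eq_relabel_iff[of v' g v] b by simp_all
  have "preserves_first_order ?f (map ((+) ?n) (word_of v))"
  proof (cases "word_of v = []")
    case False
    then show ?thesis using pv(2) fg by (simp add: preserves_first_order_def hd_map)
  qed (simp add: preserves_first_order_def)
  note first_high = this
  have "preserves_first_order ?f (word_of u)"
    by (rule preserves_first_order_shuffle[where n = ?n and u = "word_of u", unfolded low high])
      (use pw(2) first_high keep in simp_all)
  moreover have "preserves_factor_max ?f (word_of u)"
    by (rule preserves_factor_max_shuffle[where n = ?n and u = "word_of u", unfolded low high])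
      (use preserves_factor_max_map_add[OF pv(1) fg] pw(1) keep in simp_all)
  ultimately show "beta u' = beta u"
    using beta_eq_relabel_iff[OF word] by simp
qed

lemma bileveled_size_beta: "bileveled_size (beta w) = perm_size w"
  by (simp add: bileveled_size_def pair_of_beta size_tau perm_size_def)

text \<open>Relabelling is a bijection between the two sets of shuffles, with the reverse relabelling as its
  inverse, and it does not change the summands.\<close>

theorem sum_beta_shuffles_cong:
  fixes G :: "bileveled \<Rightarrow> 'a::comm_monoid_add"
  assumes "beta w = beta w'" "beta v = beta v'"
  shows "(\<Sum>u\<in>shuffles_of w v. G (beta u)) = (\<Sum>u\<in>shuffles_of w' v'. G (beta u))"
proof -
  have size: "perm_size w' = perm_size w" "perm_size v' = perm_size v"
    using assms by (metis bileveled_size_beta)+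
  note there = relabel_shuffles_of[OF assms size]
  note reverse = relabel_shuffles_of[OF assms[symmetric] size[symmetric]]
  have set_u: "set (word_of u) = {1..perm_size w + perm_size v}"
    if "u \<in> shuffles_of w v \<or> u \<in> shuffles_of w' v'" for u
    using that perm_size_shuffles_of[of u] size by (auto simp: perm_word_props)
  show ?thesis
  proof (rule sum.reindex_bij_witness[where
        i = "\<lambda>u. Perm (map (relabel_shuffle w' v' w v) (word_of u))" and
        j = "\<lambda>u. Perm (map (relabel_shuffle w v w' v') (word_of u))"])
    fix u assume u: "u \<in> shuffles_of w v"
    have "map (relabel_shuffle w' v' w v) (map (relabel_shuffle w v w' v') (word_of u)) = word_of u"
      using set_u u relabel_shuffle_inverse[OF size] unfolding map_map by (intro map_idI) simp
    then show "Perm (map (relabel_shuffle w' v' w v)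
        (word_of (Perm (map (relabel_shuffle w v w' v') (word_of u))))) = u"
      using there(1)[OF u] by (simp only: word_of_inverse)
  next
    fix u assume u: "u \<in> shuffles_of w' v'"
    have "map (relabel_shuffle w v w' v') (map (relabel_shuffle w' v' w v) (word_of u)) = word_of u"
      using set_u u relabel_shuffle_inverse[OF size[symmetric]] size
      unfolding map_map by (intro map_idI) simp
    then show "Perm (map (relabel_shuffle w v w' v')
        (word_of (Perm (map (relabel_shuffle w' v' w v) (word_of u))))) = u"
      using reverse(1)[OF u] by (simp only: word_of_inverse)
  qed (simp_all add: there reverse)
qed

section \<open>Surjectivity onto bi-leveled trees\<close>

lemma is_perm_word_standardize:
  assumes "distinct a"
  shows "is_perm_word (standardize a)"
proof -
  have "set (standardize a) \<subseteq> {1..length a}"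
  proof
    fix c assume "c \<in> set (standardize a)"
    then obtain x where x: "x \<in> set a" "c = card {y \<in> set a. y \<le> x}"
      by (auto simp: standardize_def)
    have "x \<in> {y \<in> set a. y \<le> x}" using x by simp
    then have "0 < c" unfolding x(2) by (auto simp: card_gt_0_iff)
    moreover have "c \<le> card (set a)" unfolding x(2) by (intro card_mono) auto
    ultimately show "c \<in> {1..length a}" using card_length[of a] by auto
  qed
  moreover have "card (set (standardize a)) = length a"
    using distinct_card[OF distinct_standardize[OF assms]] by simp
  ultimately have "set (standardize a) = {1..length a}"
    by (intro card_subset_eq) auto
  then show ?thesis
    using distinct_standardize[OF assms] by (simp add: is_perm_word_def)
qed

text \<open>Distinct letters are all that matters here; an actual permutation is obtained at the end by
  standardizing.\<close>

lemma tau_surj: "\<exists>w. distinct w \<and> tau w = t"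
proof (induction t)
  case Leaf
  show ?case by (rule exI[of _ "[]"]) simp
next
  case (Node l x r)
  then obtain a b where a: "distinct a" "tau a = l" and b: "distinct b" "tau b = r" by blast
  \<comment> \<open>\<open>N\<close> shifts the right word above the letters of the left one, and \<open>M\<close> exceeds all of them.\<close>
  define N where "N = Suc (sum_list a)"
  define M where "M = N + Suc (sum_list b)"
  have "y < N" if "y \<in> set a" for y using member_le_sum_list[OF that] by (simp add: N_def)
  moreover have "N \<le> N + y \<and> N + y < M" if "y \<in> set b" for y
    using member_le_sum_list[OF that] by (simp add: M_def)
  ultimately have "distinct (a @ M # map ((+) N) b)"
    and "tau (a @ M # map ((+) N) b) = tau a \<or>\<^sub>t tau (map ((+) N) b)"
    using a(1) b(1)
    by (fastforce simp: distinct_map M_def, intro tau_split) (fastforce simp: M_def)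
  moreover have "tau (map ((+) N) b) = r"
    using b(2) by (subst tau_map) (auto simp: strict_mono_on_def)
  ultimately show ?case
    using a(2) by (intro exI[of _ "a @ M # map ((+) N) b"]) simp
qed

lemma upt_split: "[1..<Suc (m + 1 + n)] = [1..<Suc m] @ (m + 1) # map ((+) (m + 1)) [1..<Suc n]"
proof -
  have "[1..<Suc (m + 1 + n)] = [1..<Suc m] @ [Suc m..<Suc m + Suc n]"
    using upt_add_eq_append[of 1 "Suc m" "Suc n"] by simp
  also have "[Suc m..<Suc m + Suc n] = (m + 1) # [m + 2..<m + 2 + n]"
    by (simp add: upt_rec[of "Suc m"])
  also have "[m + 2..<m + 2 + n] = map ((+) (m + 1)) [1..<Suc n]"
    by (rule nth_equalityI) (simp_all del: upt_Suc)
  finally show ?thesis .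
qed

text \<open>Reading off the labels of an increasing labelling from left to right recovers the tree, since the
  root carries the largest label. That every label is bounded by the label of the root is proved
  along with it, because the induction step needs it for both subtrees.\<close>

lemma tau_linear_extension:
  assumes "\<And>i j. (i, j) \<in> internal_edges t \<Longrightarrow> k i < k j"
  shows "tau (map k [1..<Suc (size t)]) = t \<and> (\<forall>i\<in>{1..size t}. k i \<le> k (root_node t))"
  using assms
proof (induction t arbitrary: k)
  case (Node l x r)
  let ?s = "size l + 1"
  have IHl: "tau (map k [1..<Suc (size l)]) = l" "\<forall>i\<in>{1..size l}. k i \<le> k (root_node l)"
    using Node.IH(1)[of k] Node.prems by auto
  have edge_r: "k (?s + i) < k (?s + j)" if "(i, j) \<in> internal_edges r" for i j
  proof -
    have "(i + ?s, j + ?s) \<in> internal_edges (Node l x r)"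
      using that by (force simp: image_iff)
    then show ?thesis using Node.prems by (simp add: add.commute)
  qed
  have IHr: "tau (map (\<lambda>i. k (?s + i)) [1..<Suc (size r)]) = r"
    "\<forall>i\<in>{1..size r}. k (?s + i) \<le> k (?s + root_node r)"
    using Node.IH(2)[of "\<lambda>i. k (?s + i)"] edge_r by auto
  have l: "k i < k ?s" if "i \<in> {1..size l}" for i
  proof -
    have "(root_node l, ?s) \<in> internal_edges (Node l x r)" using that by auto
    then have "k (root_node l) < k ?s" by (rule Node.prems)
    then show ?thesis using IHl(2) that by force
  qed
  have r: "k (?s + i) < k ?s" if "i \<in> {1..size r}" for i
  proof -
    have "(root_node r + ?s, ?s) \<in> internal_edges (Node l x r)" using that by auto
    then have "k (root_node r + ?s) < k ?s" by (rule Node.prems)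
    then show ?thesis using IHr(2) that by (force simp: add.commute)
  qed
  have word: "map k [1..<Suc (size (Node l x r))] =
      map k [1..<Suc (size l)] @ k ?s # map (\<lambda>i. k (?s + i)) [1..<Suc (size r)]"
    using upt_split[of "size l" "size r"] by (simp add: o_def del: upt_Suc)
  have "tau (map k [1..<Suc (size (Node l x r))]) = l \<or>\<^sub>t r"
    unfolding word
    by (subst tau_split) (use l r IHl(1) IHr(1) in \<open>auto simp del: upt_Suc\<close>)
  moreover have "k i \<le> k (root_node (Node l x r))" if i: "i \<in> {1..size (Node l x r)}" for i
  proof -
    consider "i \<in> {1..size l}" | "i = ?s" | "i = ?s + (i - ?s)" "i - ?s \<in> {1..size r}"
      using i by fastforce
    then show ?thesis
    proof cases
      case 3
      then show ?thesis using r[OF 3(2)] by simp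
    qed (use l[of i] in auto)
  qed
  ultimately show ?case by simp
qed simp

text \<open>Given a bi-leveled tree, label its nodes so that the labels increase along the edges, all nodes
  outside the ideal come first, node 1 comes next and the other nodes of the ideal come last. Such
  a labelling exists because the ideal is closed upwards and node 1 is minimal in it; its word has
  the prescribed tree, and the letters not below the first one sit exactly at the nodes of the
  ideal.\<close>

theorem surj_beta: "surj beta"
proof -
  have "\<exists>w. beta w = b" for b
  proof -
    obtain t T where b: "pair_of b = (t, T)" by fastforce
    have bil: "is_bileveled (t, T)" using pair_of[of b] b by simp
    have T: "T \<subseteq> {1..size t}" and up: "\<And>i j. i \<in> T \<Longrightarrow> node_le t i j \<Longrightarrow> j \<in> T"
      using bil by (auto simp: is_bileveled_def upper_order_ideal_def)
    have T1: "t \<noteq> Leaf \<Longrightarrow> 1 \<in> T" "\<And>i. t \<noteq> Leaf \<Longrightarrow> i \<in> T \<Longrightarrow> node_le t i 1 \<Longrightarrow> i = 1"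
      using bil by (auto simp: is_bileveled_def)
    obtain u where u: "distinct u" "tau u = t" using tau_surj by blast
    have len: "length u = size t" using size_tau u(2) by metis
    define N where "N = Suc (sum_list u)"
    have bound: "u ! (i - 1) < N" if "i \<in> {1..size t}" for i
      using member_le_sum_list[of "u ! (i - 1)" u] nth_mem[of "i - 1" u] that len
      by (auto simp: N_def less_Suc_eq_le)
    \<comment> \<open>The word \<open>u\<close> gives some increasing labelling; the bound \<open>N\<close>, which becomes the label of
        node 1, separates the two levels.\<close>
    define k where
      "k i = (if i \<notin> T then u ! (i - 1) else if i = 1 then N else Suc (N + u ! (i - 1)))" for i
    have edges: "k i < k j" if e: "(i, j) \<in> internal_edges t" for i j
    proof -
      have ij: "i \<in> {1..size t}" "j \<in> {1..size t}" using e internal_edges_bounds[of t] by auto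
      then have ne: "t \<noteq> Leaf" and le: "node_le t i j" using e by (auto simp: node_le_def)
      have less: "u ! (i - 1) < u ! (j - 1)" using internal_edges_tau_less[OF u(1)] e u(2) by simp
      have "i \<in> T \<Longrightarrow> j \<in> T \<and> j \<noteq> 1" using up[OF _ le] T1(2)[OF ne, of i] le less by auto
      then show ?thesis using less bound[OF ij(1)] bound[OF ij(2)] by (auto simp: k_def)
    qed
    define a where "a = map k [1..<Suc (size t)]"
    have nth_u: "u ! (i - 1) = u ! (j - 1) \<longleftrightarrow> i = j" if "i \<in> {1..size t}" "j \<in> {1..size t}" for i j
      using that u(1) len by (subst nth_eq_iff_index_eq) auto
    have "inj_on k {1..size t}"
    proof (rule inj_onI)
      fix i j assume ij: "i \<in> {1..size t}" "j \<in> {1..size t}" and "k i = k j"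
      then show "i = j"
        using nth_u[OF ij] bound[OF ij(1)] bound[OF ij(2)] by (auto simp: k_def split: if_splits)
    qed
    then have dist: "distinct a"
      by (simp add: a_def distinct_map atLeastLessThanSuc_atLeastAtMost del: upt_Suc)
    have "word_of (Perm (standardize a)) = standardize a"
      using is_perm_word_standardize[OF dist] by (rule word_of_Perm)
    moreover have "tau (standardize a) = t"
      using tau_linear_extension[of t k] edges by (simp add: tau_standardize a_def)
    moreover have "upper_nodes (standardize a) = T"
    proof -
      have len_a: "length a = size t" by (simp add: a_def del: upt_Suc)
      have "i \<in> upper_nodes (standardize a) \<longleftrightarrow> i \<in> T" for i
      proof (cases "i \<in> {1..size t}")
        case True
        then have "t \<noteq> Leaf" by auto
        then have "k 1 = N" using T1(1) by (simp add: k_def)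
        have "i \<in> upper_nodes (standardize a) \<longleftrightarrow> standardize a ! 0 \<le> standardize a ! (i - 1)"
          using True by (simp add: upper_nodes_def len_a)
        also have "standardize a ! 0 \<le> standardize a ! (i - 1) \<longleftrightarrow> a ! 0 \<le> a ! (i - 1)"
          using standardize_less_iff[of "i - 1" a 0] True len_a by (auto simp: not_less[symmetric])
        also have "\<dots> \<longleftrightarrow> k 1 \<le> k i"
          using True by (cases "size t") (auto simp: a_def simp del: upt_Suc)
        also have "\<dots> \<longleftrightarrow> i \<in> T"
          using bound[OF True] unfolding \<open>k 1 = N\<close> by (auto simp: k_def)
        finally show ?thesis .
      qed (use T len_a in \<open>auto simp: upper_nodes_def\<close>)
      then show ?thesis by blast
    qed
    ultimately have "pair_of (beta (Perm (standardize a))) = pair_of b"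
      by (simp add: pair_of_beta b)
    then have "beta (Perm (standardize a)) = b" by (simp only: pair_of_inject)
    then show ?thesis by (rule exI)
  qed
  then show ?thesis by (metis surj_def)
qed

section \<open>Graded algebras from structure constants\<close>

lemma lookup_pm_scale [simp]: "Poly_Mapping.lookup (pm_scale c f) b = c * Poly_Mapping.lookup f b"
  by (simp add: pm_scale_def Poly_Mapping.map.rep_eq when_def)

lemma keys_pm_scale: "Poly_Mapping.keys (pm_scale c f) \<subseteq> Poly_Mapping.keys f"
  by (auto simp: in_keys_iff)

interpretation pm: vector_space "pm_scale :: rat \<Rightarrow> ('b \<Rightarrow>\<^sub>0 rat) \<Rightarrow> ('b \<Rightarrow>\<^sub>0 rat)"
  by unfold_locales (auto intro!: poly_mapping_eqI simp: lookup_add algebra_simps)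

abbreviation pm_linear :: "(('b \<Rightarrow>\<^sub>0 rat) \<Rightarrow> ('c \<Rightarrow>\<^sub>0 rat)) \<Rightarrow> bool" where
  "pm_linear \<equiv> Vector_Spaces.linear pm_scale pm_scale"

lemma pm_linearI:
  assumes "\<And>f g. L (f + g) = L f + L g" "\<And>c f. L (pm_scale c f) = pm_scale c (L f)"
  shows "pm_linear L"
  unfolding Vector_Spaces.linear_iff
  by (intro conjI allI assms pm.vector_space_axioms)

lemma pm_linear_sum: "pm_linear L \<Longrightarrow> L (sum g A) = (\<Sum>a\<in>A. L (g a))"
  using module_hom.sum Vector_Spaces.linear.axioms(3) module_hom_iff_linear by blast

lemma pm_linear_scale: "pm_linear L \<Longrightarrow> L (pm_scale c f) = pm_scale c (L f)"
  unfolding Vector_Spaces.linear_iff by blast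

lemma pm_linear_add: "pm_linear L \<Longrightarrow> L (f + g) = L f + L g"
  unfolding Vector_Spaces.linear_iff by blast

lemma pm_linear_compose: "pm_linear L \<Longrightarrow> pm_linear M \<Longrightarrow> pm_linear (\<lambda>f. M (L f))"
  by (simp add: pm_linearI pm_linear_add pm_linear_scale)

lemma pm_expand: "f = (\<Sum>b\<in>Poly_Mapping.keys f. pm_scale (Poly_Mapping.lookup f b) (F b))"
  by (rule poly_mapping_eqI)
    (simp add: lookup_sum lookup_single when_def in_keys_iff if_distrib sum.delta' cong: if_cong)

lemma pm_linear_eqI:
  assumes "pm_linear L" "pm_linear M" "\<And>b. L (F b) = M (F b)"
  shows "L f = M f"
  by (subst (1 2) pm_expand[of f])
    (simp only: pm_linear_sum[OF assms(1)] pm_linear_sum[OF assms(2)]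
      pm_linear_scale[OF assms(1)] pm_linear_scale[OF assms(2)] assms(3))

lemma linear_ext_F_self: "linear_ext F f = f"
  unfolding linear_ext_def by (rule pm_expand[symmetric])

lemma linear_ext_superset:
  assumes "finite S" "Poly_Mapping.keys f \<subseteq> S"
  shows "linear_ext \<phi> f = (\<Sum>b\<in>S. pm_scale (Poly_Mapping.lookup f b) (\<phi> b))"
  unfolding linear_ext_def using assms
  by (intro sum.mono_neutral_left) (auto simp: in_keys_iff)

lemma linear_ext_linear: "pm_linear (linear_ext \<phi>)"
proof (rule pm_linearI)
  fix f g :: "'a \<Rightarrow>\<^sub>0 rat"
  let ?S = "Poly_Mapping.keys f \<union> Poly_Mapping.keys g"
  show "linear_ext \<phi> (f + g) = linear_ext \<phi> f + linear_ext \<phi> g"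
    using keys_add[of f g]
    by (simp add: linear_ext_superset[of ?S] lookup_add pm.scale_left_distrib sum.distrib)
next
  fix c and f :: "'a \<Rightarrow>\<^sub>0 rat"
  show "linear_ext \<phi> (pm_scale c f) = pm_scale c (linear_ext \<phi> f)"
    by (simp add: linear_ext_superset[of "Poly_Mapping.keys f"] keys_pm_scale pm.scale_sum_right)
qed

lemma linear_ext_F [simp]: "linear_ext \<phi> (F b) = \<phi> b"
  by (simp add: linear_ext_def)

lemma keys_linear_ext:
  "Poly_Mapping.keys (linear_ext \<phi> f) \<subseteq> (\<Union>b\<in>Poly_Mapping.keys f. Poly_Mapping.keys (\<phi> b))"
  unfolding linear_ext_def using keys_sum keys_pm_scale by fastforce

lemma bilinear_ext_linear_left: "pm_linear (\<lambda>f. bilinear_ext \<mu> f g)"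
  unfolding bilinear_ext_def by (rule linear_ext_linear)

lemma bilinear_ext_linear_right: "pm_linear (bilinear_ext \<mu> f)"
  unfolding bilinear_ext_def linear_ext_def[of _ f]
  by (rule pm_linearI)
    (simp_all add: pm_linear_add[OF linear_ext_linear] pm_linear_scale[OF linear_ext_linear]
      pm.scale_right_distrib sum.distrib pm.scale_sum_right mult.commute)

lemma bilinear_ext_F [simp]: "bilinear_ext \<mu> (F b) (F c) = \<mu> b c"
  by (simp add: bilinear_ext_def)

lemma pm_bilinear_eqI:
  assumes "\<And>g. pm_linear (\<lambda>f. B f g)" "\<And>f. pm_linear (B f)"
    and "\<And>g. pm_linear (\<lambda>f. C f g)" "\<And>f. pm_linear (C f)"
    and "\<And>b c. B (F b) (F c) = C (F b) (F c)"
  shows "B f g = C f g"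
  by (rule pm_linear_eqI[OF assms(1,3)], rule pm_linear_eqI[OF assms(2,4)], rule assms(5))

text \<open>Each basis element lies in one degree only, so a coefficient of a sum of homogeneous elements comes
  from a single summand. Both the existence and the uniqueness of homogeneous components rest on
  this.\<close>

lemma lookup_sum_homogeneous:
  assumes "\<And>n. c n \<in> {f. \<forall>b\<in>Poly_Mapping.keys f. sz b = n}" "finite {n. c n \<noteq> 0}"
  shows "Poly_Mapping.lookup (\<Sum>n\<in>{n. c n \<noteq> 0}. c n) b = Poly_Mapping.lookup (c (sz b)) b"
proof -
  have "Poly_Mapping.lookup (c n) b = (if n = sz b then Poly_Mapping.lookup (c (sz b)) b else 0)" for n
    using assms(1)[of n] by (auto simp: in_keys_iff)
  then have "Poly_Mapping.lookup (\<Sum>n\<in>{n. c n \<noteq> 0}. c n) b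
      = (\<Sum>n\<in>{n. c n \<noteq> 0}. if n = sz b then Poly_Mapping.lookup (c (sz b)) b else 0)"
    unfolding lookup_sum by (intro sum.cong) auto
  then show ?thesis using assms(2) by simp
qed

lemma homogeneous_decomposition:
  fixes x :: "'b \<Rightarrow>\<^sub>0 rat" and sz :: "'b \<Rightarrow> nat"
  defines "H \<equiv> (\<lambda>n. {f :: 'b \<Rightarrow>\<^sub>0 rat. \<forall>b\<in>Poly_Mapping.keys f. sz b = n})"
  shows "\<exists>!c. (\<forall>n. c n \<in> H n) \<and> finite {n. c n \<noteq> 0} \<and> x = (\<Sum>n\<in>{n. c n \<noteq> 0}. c n)"
proof (rule ex1I)
  define part where "part = (\<lambda>n. Poly_Mapping.mapp (\<lambda>b a. a when sz b = n) x)"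
  have lookup_c: "Poly_Mapping.lookup (part n) b = (Poly_Mapping.lookup x b when sz b = n)" for n b
    by (auto simp: part_def lookup_mapp when_def in_keys_iff)
  have hom: "part n \<in> H n" for n
    unfolding H_def by (auto simp: in_keys_iff lookup_c)
  have "{n. part n \<noteq> 0} \<subseteq> sz ` Poly_Mapping.keys x"
  proof
    fix n assume "n \<in> {n. part n \<noteq> 0}"
    then obtain b where "Poly_Mapping.lookup (part n) b \<noteq> 0"
      by (metis (mono_tags, lifting) lookup_zero mem_Collect_eq poly_mapping_eqI)
    then have "b \<in> Poly_Mapping.keys x" "n = sz b"
      by (auto simp: lookup_c when_def in_keys_iff split: if_splits)
    then show "n \<in> sz ` Poly_Mapping.keys x" by blast
  qed
  then have fin: "finite {n. part n \<noteq> 0}" by (rule finite_subset) simp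
  have "x = (\<Sum>n\<in>{n. part n \<noteq> 0}. part n)"
    by (rule poly_mapping_eqI, subst lookup_sum_homogeneous[where sz = sz])
      (use hom fin in \<open>simp_all add: H_def lookup_c\<close>)
  with hom fin show "(\<forall>n. part n \<in> H n) \<and> finite {n. part n \<noteq> 0} \<and> x = (\<Sum>n\<in>{n. part n \<noteq> 0}. part n)"
    by blast
  fix d assume d: "(\<forall>n. d n \<in> H n) \<and> finite {n. d n \<noteq> 0} \<and> x = (\<Sum>n\<in>{n. d n \<noteq> 0}. d n)"
  have lookup_d: "Poly_Mapping.lookup x b = Poly_Mapping.lookup (d (sz b)) b" for b
    using lookup_sum_homogeneous[of d sz b] d unfolding H_def by metis
  show "d = part"
  proof (rule ext, rule poly_mapping_eqI)
    fix n b
    have "sz b \<noteq> n \<Longrightarrow> Poly_Mapping.lookup (d n) b = 0"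
      using d unfolding H_def by (metis (mono_tags, lifting) mem_Collect_eq in_keys_iff)
    then show "Poly_Mapping.lookup (d n) b = Poly_Mapping.lookup (part n) b"
      by (simp add: lookup_c when_def lookup_d)
  qed
qed

text \<open>Both sides of each algebra law are linear in every argument, so the laws need only be checked on
  basis elements; the degree 0 part is spanned by the unit because no other basis element lives
  there. Both algebras below arise in this way.\<close>

theorem graded_connected_algebra_bilinear_ext:
  fixes \<mu> :: "'b \<Rightarrow> 'b \<Rightarrow> ('b \<Rightarrow>\<^sub>0 rat)" and sz :: "'b \<Rightarrow> nat"
  assumes assoc: "\<And>b c d. bilinear_ext \<mu> (\<mu> b c) (F d) = bilinear_ext \<mu> (F b) (\<mu> c d)"
    and unit: "\<And>b. \<mu> e b = F b" "\<And>b. \<mu> b e = F b"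
    and size: "\<And>a b c. a \<in> Poly_Mapping.keys (\<mu> b c) \<Longrightarrow> sz a = sz b + sz c"
    and size_0: "\<And>b. sz b = 0 \<longleftrightarrow> b = e"
  shows "graded_connected_algebra pm_scale (bilinear_ext \<mu>) (F e)
    (\<lambda>n. {f. \<forall>b\<in>Poly_Mapping.keys f. sz b = n})"
proof -
  let ?m = "bilinear_ext \<mu>" and ?H = "\<lambda>n. {f :: 'b \<Rightarrow>\<^sub>0 rat. \<forall>b\<in>Poly_Mapping.keys f. sz b = n}"
  note lin = bilinear_ext_linear_left bilinear_ext_linear_right
  have m_assoc: "?m (?m x y) z = ?m x (?m y z)" for x y z
  proof (rule pm_linear_eqI[where f = x])
    fix b
    show "?m (?m (F b) y) z = ?m (F b) (?m y z)"
    proof (rule pm_bilinear_eqI[where f = y and g = z])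
      fix c d show "?m (?m (F b) (F c)) (F d) = ?m (F b) (?m (F c) (F d))" using assoc by simp
    qed (intro lin pm_linear_compose[OF lin(1)] pm_linear_compose[OF lin(2)])+
  qed (intro lin pm_linear_compose[OF lin(1)] pm_linear_compose[OF lin(2)])+
  have id: "pm_linear (\<lambda>x :: 'b \<Rightarrow>\<^sub>0 rat. x)" by (simp add: pm_linearI)
  have m_one: "?m (F e) x = x" "?m x (F e) = x" for x
    by (rule pm_linear_eqI[where f = x], intro lin, rule id, simp add: unit)+
  have sub: "pm.subspace (?H n)" for n
    using keys_add keys_pm_scale by (fastforce intro!: pm.subspaceI)
  have H_mult: "?m x y \<in> ?H (m + n)" if x: "x \<in> ?H m" and y: "y \<in> ?H n" for x y m n
  proof -
    have "sz a = m + n" if a: "a \<in> Poly_Mapping.keys (?m x y)" for a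
    proof -
      obtain b c where "b \<in> Poly_Mapping.keys x" "c \<in> Poly_Mapping.keys y"
        "a \<in> Poly_Mapping.keys (\<mu> b c)"
        using a keys_linear_ext[of "\<lambda>b. linear_ext (\<mu> b) y" x] keys_linear_ext[of "\<mu> _" y]
        unfolding bilinear_ext_def by blast
      then show ?thesis using size x y by auto
    qed
    then show ?thesis by blast
  qed
  have span: "?H 0 = pm.span {F e}"
  proof
    show "?H 0 \<subseteq> pm.span {F e}"
    proof
      fix f assume "f \<in> ?H 0"
      then have "Poly_Mapping.lookup f b = 0" if "b \<noteq> e" for b
        using that by (auto simp: size_0 in_keys_iff)
      then have "f = pm_scale (Poly_Mapping.lookup f e) (F e)"
        by (intro poly_mapping_eqI) (auto simp: lookup_single when_def)
      then show "f \<in> pm.span {F e}" by (metis pm.span_base pm.span_scale singletonI)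
    qed
    show "pm.span {F e} \<subseteq> ?H 0" by (rule pm.span_minimal[OF _ sub]) (simp add: size_0)
  qed
  have "pm.dim (?H 0) = 1"
  proof -
    have "F e \<noteq> 0" by (metis keys_single keys_zero insert_not_empty one_neq_zero)
    then have "\<not> pm.dependent {F e}" by simp
    from pm.dim_span_eq_card_independent[OF this] show ?thesis unfolding span by simp
  qed
  moreover have "F e \<in> ?H 0" by (simp add: size_0)
  ultimately show ?thesis
    by (intro graded_connected_algebra.intro graded_algebra.intro graded_algebra_axioms.intro
        graded_connected_algebra_axioms.intro pm.vector_space_axioms lin m_assoc m_one sub
        homogeneous_decomposition H_mult span)
qed

section \<open>The algebras of permutations and of bi-leveled trees\<close>

lemma ssym_mult_F: "ssym_mult (F w) (F v) = (\<Sum>u\<in>shuffles_of w v. F u)"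
  by (simp add: ssym_mult_def sum.reindex_bij_betw[OF bij_betw_shuffle, of F])

lemma ssym_mult_linear: "pm_linear (\<lambda>f. ssym_mult f g)" "pm_linear (ssym_mult f)"
  unfolding ssym_mult_def by (rule bilinear_ext_linear_left bilinear_ext_linear_right)+

text \<open>Both iterated products sum over \<^const>\<open>triple_shuffles\<close>.\<close>

lemma ssym_mult_assoc_F:
  "ssym_mult (ssym_mult (F w) (F v)) (F z) = ssym_mult (F w) (ssym_mult (F v) (F z))"
proof -
  have "ssym_mult (ssym_mult (F w) (F v)) (F z)
      = (\<Sum>u\<in>shuffles_of w v. \<Sum>x\<in>shuffles_of u z. F x)"
    by (simp add: ssym_mult_F[of w v] pm_linear_sum[OF ssym_mult_linear(1)] ssym_mult_F)
  also have "\<dots> = (\<Sum>x\<in>triple_shuffles w v z. F x)"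
    unfolding Union_shuffles_of_left[symmetric]
    by (rule sum.UNION_disjoint[symmetric])
      (use finite_shuffles_of disjoint_shuffles_of_left in blast)+
  also have "\<dots> = (\<Sum>y\<in>shuffles_of v z. \<Sum>x\<in>shuffles_of w y. F x)"
    unfolding Union_shuffles_of_right[symmetric]
    by (rule sum.UNION_disjoint)
      (use finite_shuffles_of disjoint_shuffles_of_right in blast)+
  also have "\<dots> = ssym_mult (F w) (ssym_mult (F v) (F z))"
    by (simp add: ssym_mult_F[of v z] pm_linear_sum[OF ssym_mult_linear(2)] ssym_mult_F)
  finally show ?thesis .
qed

lemma keys_sum_F: "Poly_Mapping.keys (\<Sum>a\<in>A. F (g a)) \<subseteq> g ` A"
  using keys_sum[of "\<lambda>a. F (g a)" A] by auto

lemma perm_size_eq_0: "perm_size w = 0 \<longleftrightarrow> w = Perm []"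
  by (metis length_0_conv perm_size_def word_of_inverse word_of_Perm_Nil)

lemma bileveled_size_eq_0: "bileveled_size b = 0 \<longleftrightarrow> b = Bileveled (Leaf, {})"
proof
  assume "bileveled_size b = 0"
  then obtain T where b: "pair_of b = (Leaf, T)"
    by (metis bileveled_size_def eq_size_0 prod.collapse)
  then have "T = {}" using pair_of[of b] by (auto simp: is_bileveled_def upper_order_ideal_def)
  with b show "b = Bileveled (Leaf, {})" by (metis pair_of_inverse)
qed (simp add: bileveled_size_def pair_of_Bileveled_Leaf)

theorem ssym_graded_connected_algebra:
  "graded_connected_algebra pm_scale ssym_mult ssym_one ssym_hcomp"
proof -
  let ?\<mu> = "\<lambda>w v. \<Sum>is\<in>cuts (perm_size w) (perm_size v). F (shuffle w v is)"
  have \<mu>: "?\<mu> w v = ssym_mult (F w) (F v)" for w v by (simp add: ssym_mult_def)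
  have "graded_connected_algebra pm_scale (bilinear_ext ?\<mu>) (F (Perm []))
      (\<lambda>n. {f. \<forall>b\<in>Poly_Mapping.keys f. perm_size b = n})"
  proof (rule graded_connected_algebra_bilinear_ext)
    show "bilinear_ext ?\<mu> (?\<mu> b c) (F d) = bilinear_ext ?\<mu> (F b) (?\<mu> c d)" for b c d
      using ssym_mult_assoc_F[of b c d] by (simp only: ssym_mult_def bilinear_ext_F)
    show "?\<mu> (Perm []) b = F b" "?\<mu> b (Perm []) = F b" for b
      unfolding \<mu> ssym_mult_F by (simp_all add: shuffles_of_Nil_left shuffles_of_Nil_right)
    show "perm_size a = perm_size b + perm_size c" if "a \<in> Poly_Mapping.keys (?\<mu> b c)" for a b c
      using that keys_sum_F[of "\<lambda>u. u" "shuffles_of b c"] perm_size_shuffles_of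
      unfolding \<mu> ssym_mult_F by auto
  qed (rule perm_size_eq_0)
  then show ?thesis by (simp only: ssym_mult_def ssym_one_def ssym_hcomp_def[abs_def])
qed

lemma beta_lin_F [simp]: "beta_lin (F w) = F (beta w)"
  by (simp add: beta_lin_def)

lemma beta_lin_linear: "pm_linear beta_lin"
  unfolding beta_lin_def by (rule linear_ext_linear)

lemma beta_lin_ssym_mult_F:
  "beta_lin (ssym_mult (F w) (F v)) = (\<Sum>u\<in>shuffles_of w v. F (beta u))"
  by (simp add: ssym_mult_F pm_linear_sum[OF beta_lin_linear])

lemma beta_lin_ssym_mult_cong:
  "beta w = beta w' \<Longrightarrow> beta v = beta v' \<Longrightarrow>
     beta_lin (ssym_mult (F w) (F v)) = beta_lin (ssym_mult (F w') (F v'))"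
  unfolding beta_lin_ssym_mult_F by (rule sum_beta_shuffles_cong)

text \<open>The representatives chosen by \<^const>\<open>msym_mult\<close> may be replaced by any others.\<close>

lemma msym_mult_F: "msym_mult (F (beta w)) (F (beta v)) = beta_lin (ssym_mult (F w) (F v))"
  unfolding msym_mult_def bilinear_ext_F
  by (rule beta_lin_ssym_mult_cong) (rule someI[where P = "\<lambda>x. beta x = beta _"], rule refl)+

lemma msym_mult_linear: "pm_linear (\<lambda>f. msym_mult f g)" "pm_linear (msym_mult f)"
  unfolding msym_mult_def by (rule bilinear_ext_linear_left bilinear_ext_linear_right)+

lemma beta_lin_mult: "beta_lin (ssym_mult f g) = msym_mult (beta_lin f) (beta_lin g)"
proof (rule pm_bilinear_eqI[where f = f and g = g])
  show "beta_lin (ssym_mult (F w) (F v)) = msym_mult (beta_lin (F w)) (beta_lin (F v))" for w v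
    by (simp add: msym_mult_F)
  show "pm_linear (\<lambda>f. beta_lin (ssym_mult f g))" "pm_linear (\<lambda>g. beta_lin (ssym_mult f g))"
    "pm_linear (\<lambda>f. msym_mult (beta_lin f) (beta_lin g))"
    "pm_linear (\<lambda>g. msym_mult (beta_lin f) (beta_lin g))" for f g
    by (rule pm_linear_compose[OF _ beta_lin_linear] pm_linear_compose[OF beta_lin_linear]
        ssym_mult_linear msym_mult_linear)+
qed

lemma beta_lin_one: "beta_lin ssym_one = msym_one"
proof -
  have "beta (Perm []) = Bileveled (Leaf, {})"
    unfolding bileveled_size_eq_0[symmetric] by (simp add: bileveled_size_beta perm_size_eq_0)
  then show ?thesis by (simp add: ssym_one_def msym_one_def)
qed

lemma surj_beta_lin: "surj beta_lin"
proof (rule surjI)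
  fix f :: msym
  have "beta_lin (linear_ext (\<lambda>b. F (inv beta b)) f) = linear_ext F f"
    by (rule pm_linear_eqI[OF pm_linear_compose[OF linear_ext_linear beta_lin_linear]
          linear_ext_linear]) (simp add: surj_f_inv_f[OF surj_beta])
  then show "beta_lin (linear_ext (\<lambda>b. F (inv beta b)) f) = f"
    by (simp only: linear_ext_F_self)
qed

text \<open>Since \<^const>\<open>beta_lin\<close> is multiplicative and every basis element of the target is the image of one
  of the source, associativity and the unit laws are inherited.\<close>

theorem msym_graded_connected_algebra:
  "graded_connected_algebra pm_scale msym_mult msym_one msym_hcomp"
proof -
  let ?\<mu> = "\<lambda>b c. beta_lin (ssym_mult (F (SOME w. beta w = b)) (F (SOME v. beta v = c)))"
  have \<mu>: "?\<mu> b c = msym_mult (F b) (F c)" for b c by (simp add: msym_mult_def)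
  interpret S: graded_connected_algebra pm_scale ssym_mult ssym_one ssym_hcomp
    by (rule ssym_graded_connected_algebra)
  have "graded_connected_algebra pm_scale (bilinear_ext ?\<mu>) (F (Bileveled (Leaf, {})))
      (\<lambda>n. {f. \<forall>b\<in>Poly_Mapping.keys f. bileveled_size b = n})"
  proof (rule graded_connected_algebra_bilinear_ext)
    fix b c d
    obtain w v z where bcd: "b = beta w" "c = beta v" "d = beta z"
      using surj_beta unfolding surj_def by metis
    have "msym_mult (msym_mult (F b) (F c)) (F d) = msym_mult (F b) (msym_mult (F c) (F d))"
      unfolding bcd beta_lin_F[symmetric] beta_lin_mult[symmetric] S.mult_assoc ..
    then show "bilinear_ext ?\<mu> (?\<mu> b c) (F d) = bilinear_ext ?\<mu> (F b) (?\<mu> c d)"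
      by (simp only: msym_mult_def bilinear_ext_F)
    have "msym_mult msym_one (F b) = F b" "msym_mult (F b) msym_one = F b"
      unfolding bcd beta_lin_F[symmetric] beta_lin_one[symmetric] beta_lin_mult[symmetric]
        S.mult_one_left S.mult_one_right by (rule refl)+
    then show "?\<mu> (Bileveled (Leaf, {})) b = F b" "?\<mu> b (Bileveled (Leaf, {})) = F b"
      unfolding \<mu> by (simp_all only: msym_one_def)
    fix a assume "a \<in> Poly_Mapping.keys (?\<mu> b c)"
    then have "a \<in> Poly_Mapping.keys (\<Sum>u\<in>shuffles_of w v. F (beta u))"
      unfolding \<mu> unfolding bcd msym_mult_F beta_lin_ssym_mult_F .
    then obtain u where "u \<in> shuffles_of w v" "a = beta u" 
      using keys_sum_F[of beta "shuffles_of w v"] by blast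
    then show "bileveled_size a = bileveled_size b + bileveled_size c"
      by (simp add: bcd bileveled_size_beta perm_size_shuffles_of)
  qed (rule bileveled_size_eq_0)
  then show ?thesis by (simp only: msym_mult_def msym_one_def msym_hcomp_def[abs_def])
qed

theorem beta_lin_graded_connected_algebra_hom:
  "graded_connected_algebra_hom pm_scale ssym_mult ssym_one ssym_hcomp
     pm_scale msym_mult msym_one msym_hcomp beta_lin"
proof (intro graded_connected_algebra_hom.intro graded_connected_algebra_hom_axioms.intro
    ssym_graded_connected_algebra msym_graded_connected_algebra beta_lin_linear
    beta_lin_mult beta_lin_one)
  fix f n assume "f \<in> ssym_hcomp n"
  then show "beta_lin f \<in> msym_hcomp n"
    using keys_linear_ext[of "\<lambda>w. F (beta w)" f]
    by (auto simp: ssym_hcomp_def msym_hcomp_def beta_lin_def bileveled_size_beta)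
qed

theorem theorem3p1:
  shows
    "(\<forall>b c w v w' v'. beta w = b \<and> beta v = c \<and> beta w' = b \<and> beta v' = c \<longrightarrow>
        beta_lin (ssym_mult (F w) (F v)) = beta_lin (ssym_mult (F w') (F v')))
   \<and> (\<forall>b c w v. beta w = b \<and> beta v = c \<longrightarrow>
        msym_mult (F b) (F c) = beta_lin (ssym_mult (F w) (F v)))
   \<and> graded_connected_algebra pm_scale msym_mult msym_one msym_hcomp
   \<and> graded_connected_algebra_hom
        pm_scale ssym_mult ssym_one ssym_hcomp
        pm_scale msym_mult msym_one msym_hcomp
        beta_lin
   \<and> surj beta_lin"
proof (intro conjI allI impI)
  show "beta_lin (ssym_mult (F w) (F v)) = beta_lin (ssym_mult (F w') (F v'))"
    if "beta w = b \<and> beta v = c \<and> beta w' = b \<and> beta v' = c" for b c w v w' v'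
    using that by (intro beta_lin_ssym_mult_cong) simp_all
  show "msym_mult (F b) (F c) = beta_lin (ssym_mult (F w) (F v))"
    if "beta w = b \<and> beta v = c" for b c w v
    using that msym_mult_F by blast
qed (rule msym_graded_connected_algebra beta_lin_graded_connected_algebra_hom surj_beta_lin)+

end
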